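(* There exists a universal constant $K>0$ such that the following holds. (i) For any $\theta\ge0$ and $T\ge K/\theta$, there is an algorithm which, given one copy each of unknown $d$-dimensional states $\rho_1,\dots,\rho_T,\sigma_1,\dots,\sigma_T$ (i.e., given $\rho_1\otimes\cdots\otimes\rho_T\otimes\sigma_1\otimes\cdots\otimes\sigma_T$), distinguishes with probability at least $0.99$ the case $D_{\mathrm{HS}}^2(\rho_{\mathrm{avg}},\sigma_{\mathrm{avg}})\le0.99\,\theta$ from the case $D_{\mathrm{HS}}^2(\rho_{\mathrm{avg}},\sigma_{\mathrm{avg}})>\theta$. (ii) For any $\varepsilon>0$ and $T\ge K\cdot\frac{d}{\varepsilon^2}$, there is such an algorithm distinguishing with probability at least $0.99$ the case $\rho_{\mathrm{avg}}=\sigma_{\mathrm{avg}}$ from the case $D_{\mathrm{tr}}(\rho_{\mathrm{avg}},\sigma_{\mathrm{avg}})>\varepsilon$. Here $\rho_{\mathrm{avg}}=\frac1T\sum_t\rho_t$ and $\sigma_{\mathrm{avg}}=\frac1T\sum_t\sigma_t$.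
   Context: $D_{\mathrm{HS}}^2(\rho,\sigma)=\mathrm{Tr}[(\rho-\sigma)^2]$ and $D_{\mathrm{tr}}(\rho,\sigma)=\frac12\|\rho-\sigma\|_1$. The algorithm may apply any quantum measurement to the given $2T$-fold product state (chosen depending on $d,T$ and the distance parameter only) and outputs accept/reject; "distinguishes with probability at least $0.99$" means it accepts with probability at least $0.99$ in the first case and rejects with probability at least $0.99$ in the second case. *)

theory Defs
  imports "Jordan_Normal_Form.Schur_Decomposition" "Jordan_Normal_Form.Char_Poly"
begin

definition mtrace :: "complex mat \<Rightarrow> complex" where
  "mtrace A = (\<Sum>i<dim_row A. A $$ (i,i))"

definition psd :: "nat \<Rightarrow> complex mat \<Rightarrow> bool" where
  "psd n A \<longleftrightarrow> A \<in> carrier_mat n n \<and> mat_adjoint A = A \<and>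
     (\<forall>v \<in> carrier_vec n. 0 \<le> Re ((A *\<^sub>v v) \<bullet> conjugate v))"

definition density :: "nat \<Rightarrow> complex mat \<Rightarrow> bool" where
  "density d \<rho> \<longleftrightarrow> psd d \<rho> \<and> mtrace \<rho> = 1"

definition kron :: "complex mat \<Rightarrow> complex mat \<Rightarrow> complex mat" where
  "kron A B = mat (dim_row A * dim_row B) (dim_col A * dim_col B)
     (\<lambda>(i,j). A $$ (i div dim_row B, j div dim_col B) * B $$ (i mod dim_row B, j mod dim_col B))"

fun tensor_list :: "complex mat list \<Rightarrow> complex mat" where
  "tensor_list [] = 1\<^sub>m 1"
| "tensor_list (A # As) = kron A (tensor_list As)"

definition joint_state :: "nat \<Rightarrow> (nat \<Rightarrow> complex mat) \<Rightarrow> (nat \<Rightarrow> complex mat) \<Rightarrow> complex mat" where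
  "joint_state T \<rho> \<sigma> = tensor_list (map \<rho> [0..<T] @ map \<sigma> [0..<T])"

definition avg_state :: "nat \<Rightarrow> nat \<Rightarrow> (nat \<Rightarrow> complex mat) \<Rightarrow> complex mat" where
  "avg_state d T \<rho> = mat d d (\<lambda>(i,j). (\<Sum>t<T. \<rho> t $$ (i,j)) / of_nat T)"

definition D_HS_sq :: "complex mat \<Rightarrow> complex mat \<Rightarrow> real" where
  "D_HS_sq \<rho> \<sigma> = Re (mtrace ((\<rho> - \<sigma>) * (\<rho> - \<sigma>)))"

text \<open>Trace norm = sum of singular values, i.e. sum (with multiplicity) of the square roots
  of the eigenvalues of X^* X.\<close>
definition trace_norm :: "complex mat \<Rightarrow> real" where
  "trace_norm X = (\<Sum>z \<in> {x. poly (char_poly (mat_adjoint X * X)) x = 0}.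
      real (order z (char_poly (mat_adjoint X * X))) * sqrt (cmod z))"

definition D_tr :: "complex mat \<Rightarrow> complex mat \<Rightarrow> real" where
  "D_tr \<rho> \<sigma> = trace_norm (\<rho> - \<sigma>) / 2"

text \<open>Two-outcome measurement {M, I - M} on an N-dimensional system; accept = outcome M.\<close>
definition two_outcome_povm :: "nat \<Rightarrow> complex mat \<Rightarrow> bool" where
  "two_outcome_povm N M \<longleftrightarrow> psd N M \<and> psd N (1\<^sub>m N - M)"

definition accept_prob :: "complex mat \<Rightarrow> complex mat \<Rightarrow> real" where
  "accept_prob M \<rho> = Re (mtrace (M * \<rho>))"

end

theory Submission
  imports Defs "Jordan_Normal_Form.Spectral_Radius" "HOL-Analysis.L2_Norm"
begin

text \<open>Give the \<open>T\<close> copies of the first family the weight \<open>w = 1\<close> and those of the second the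
  weight \<open>w = -1\<close>, and measure the observable \<open>Y\<close> that sums \<open>w\<^sub>i w\<^sub>j SWAP\<^sub>i\<^sub>j\<close> over ordered pairs of
  distinct factors. Because the trace of \<open>SWAP\<close> against a product of two states is their overlap,
  the mean of \<open>Y\<close> is \<open>T\<^sup>2 D\<close> with \<open>D\<close> the squared Hilbert-Schmidt distance of the averages, up to
  the missing diagonal terms, which are purities and amount to at most \<open>2 T\<close>. Two swaps on disjoint
  pairs are uncorrelated, so the variance is at most \<open>T\<^sup>2 (104 + 8 T D)\<close>: swaps sharing one factor
  give traces \<open>tr (\<tau>\<^sub>i \<Delta>\<^sup>2)\<close>, where \<open>\<Delta>\<close> is the weighted sum of all states, and these are bounded by
  the squared Frobenius norm of \<open>\<Delta>\<close>. Chebyshev's inequality for the spectral measure of \<open>Y\<close> then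
  shows that the projection onto the eigenvalues at most \<open>0.995 \<theta> T\<^sup>2\<close> is a valid test. The trace
  distance case follows with \<open>\<theta> = 4 \<epsilon>\<^sup>2 / d\<close>, by Cauchy-Schwarz on the singular values.\<close>

section \<open>Unitary diagonalization of Hermitian matrices\<close>

lemma mat_adjoint_simps [simp]:
  "dim_row (mat_adjoint A) = dim_col A" "dim_col (mat_adjoint A) = dim_row A"
  "i < dim_col A \<Longrightarrow> j < dim_row A \<Longrightarrow> mat_adjoint A $$ (i,j) = conjugate (A $$ (j,i))"
  by (auto simp: mat_adjoint_def mat_of_rows_def)

lemma mat_adjoint_carrier [simp]: "A \<in> carrier_mat m n \<Longrightarrow> mat_adjoint A \<in> carrier_mat n m"
  by (intro carrier_matI) auto

lemma mat_adjoint_adjoint [simp]: "mat_adjoint (mat_adjoint A) = A"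
  by (rule eq_matI) auto

lemma mat_adjoint_mult:
  fixes A B :: "complex mat"
  assumes "A \<in> carrier_mat l m" "B \<in> carrier_mat m n"
  shows "mat_adjoint (A * B) = mat_adjoint B * mat_adjoint A"
  using assms by (intro eq_matI) (auto simp: scalar_prod_def intro!: sum.cong)

lemma mat_adjoint_one [simp]: "mat_adjoint (1\<^sub>m n :: complex mat) = 1\<^sub>m n"
  by (rule eq_matI) auto

lemma square_mult_carrier:
  "A \<in> carrier_mat n n \<Longrightarrow> B \<in> carrier_mat n n \<Longrightarrow> A * B \<in> carrier_mat n n"
  by (rule mult_carrier_mat)

lemma mult_mat_index:
  assumes "A \<in> carrier_mat l m" "B \<in> carrier_mat m n" "i < l" "j < n"
  shows "(A * B) $$ (i,j) = (\<Sum>k<m. A $$ (i,k) * B $$ (k,j))"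
  using assms by (auto simp: scalar_prod_def lessThan_atLeast0)

definition diag_of :: "nat \<Rightarrow> (nat \<Rightarrow> complex) \<Rightarrow> complex mat" where
  "diag_of n e = mat n n (\<lambda>(i,j). if i = j then e i else 0)"

lemma diag_of_carrier [simp]: "diag_of n e \<in> carrier_mat n n"
  and diag_of_dim [simp]: "dim_row (diag_of n e) = n" "dim_col (diag_of n e) = n"
  by (auto simp: diag_of_def)

lemma diag_of_index [simp]: "i < n \<Longrightarrow> j < n \<Longrightarrow> diag_of n e $$ (i,j) = (if i = j then e i else 0)"
  by (simp add: diag_of_def)

lemma diag_of_mult: "diag_of n e * diag_of n f = diag_of n (\<lambda>k. e k * f k)"
proof (rule eq_matI)
  fix i j assume "i < dim_row (diag_of n (\<lambda>k. e k * f k))" "j < dim_col (diag_of n (\<lambda>k. e k * f k))"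
  then have ij: "i < n" "j < n" by auto
  have "(diag_of n e * diag_of n f) $$ (i,j) = (\<Sum>k<n. (if i = k then e i else 0) * (if k = j then f k else 0))"
    using ij by (subst mult_mat_index[of _ n n _ n]) auto
  also have "\<dots> = (\<Sum>k<n. if k = i then (if i = j then e i * f i else 0) else 0)"
    by (rule sum.cong) auto
  finally show "(diag_of n e * diag_of n f) $$ (i,j) = diag_of n (\<lambda>k. e k * f k) $$ (i,j)"
    using ij by simp
qed auto

lemma diag_of_adjoint: "mat_adjoint (diag_of n e) = diag_of n (\<lambda>k. cnj (e k))"
  by (rule eq_matI) auto

definition unitary_mat :: "nat \<Rightarrow> complex mat \<Rightarrow> bool" where
  "unitary_mat n U \<longleftrightarrow> U \<in> carrier_mat n n \<and> mat_adjoint U * U = 1\<^sub>m n"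

text \<open>The definition asks for a left inverse only; for square matrices a left inverse is also
  a right inverse, which supplies the fourth fact.\<close>

lemma unitary_matD:
  assumes "unitary_mat n U"
  shows "U \<in> carrier_mat n n" "mat_adjoint U \<in> carrier_mat n n"
    "mat_adjoint U * U = 1\<^sub>m n" "U * mat_adjoint U = 1\<^sub>m n"
  using assms mat_mult_left_right_inverse[of "mat_adjoint U" n U] by (auto simp: unitary_mat_def)

lemma unitary_mat_mult:
  assumes U: "unitary_mat n U" and V: "unitary_mat n V"
  shows "unitary_mat n (U * V)"
proof -
  note u = unitary_matD[OF U] and v = unitary_matD[OF V]
  have "mat_adjoint (U * V) * (U * V) = mat_adjoint V * (mat_adjoint U * U) * V"
    using u(1,2) v(1,2) by (simp add: mat_adjoint_mult[OF u(1) v(1)] assoc_mult_mat[of _ n n _ n _ n] square_mult_carrier)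
  then show ?thesis using u v by (simp add: unitary_mat_def)
qed

text \<open>Complete \<open>v\<close> to a basis, orthogonalize and normalize the columns.
  Gram-Schmidt leaves its first vector alone, so column 0 is a rescaled \<open>v\<close>. This
  provides the change of basis for the deflation in \<open>hermitian_spectral\<close>.\<close>

lemma unitary_completion:
  fixes v :: "complex vec"
  assumes v: "v \<in> carrier_vec n" "v \<noteq> 0\<^sub>v n"
  obtains U c where "unitary_mat n U" "c \<noteq> 0" "col U 0 = c \<cdot>\<^sub>v v"
proof -
  have n: "n \<noteq> 0" using v by (metis eq_vecI carrier_vecD index_zero_vec(2) less_nat_zero_code)
  interpret cof_vec_space n "TYPE(complex)" .
  define ws where "ws = gram_schmidt n (basis_completion v)"
  note b = basis_completion[OF v]
  obtain vs where bv: "basis_completion v = v # vs"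
    using b(6,7) n by (cases "basis_completion v") auto
  have ws: "set ws \<subseteq> carrier_vec n" "corthogonal ws" "length ws = n"
    using gram_schmidt_result[OF b(2) b(4) b(5) refl, folded ws_def] b(6) by auto
  have hdws: "hd ws = v" unfolding ws_def using gram_schmidt_hd[OF v(1), of vs] bv by simp
  have wsi: "ws ! i \<in> carrier_vec n" if "i < n" for i using ws that by auto
  have dws [simp]: "dim_vec (ws ! i) = n" if "i < n" for i using wsi[OF that] by auto
  \<comment> \<open>The squared length of the i-th vector: \<open>corthogonal\<close> gives
    orthogonality and nonzero self-products but not unit length, so the columns of \<open>U\<close>
    are divided by \<open>sqrt (r i)\<close>.\<close>
  define r where "r i = (\<Sum>k<n. (cmod (ws ! i $ k))\<^sup>2)" for i
  have sq: "ws ! i \<bullet>c ws ! i = complex_of_real (r i)" if "i < n" for i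
    using that complex_norm_square
    by (simp add: scalar_prod_def r_def lessThan_atLeast0 del: of_real_power)
  have r: "r i > 0" if "i < n" for i
  proof -
    have "ws ! i \<bullet>c ws ! i \<noteq> 0" using corthogonalD[OF ws(2), of i i] that ws(3) by auto
    then have "r i \<noteq> 0" using sq[OF that] by simp
    moreover have "r i \<ge> 0" by (simp add: r_def sum_nonneg)
    ultimately show ?thesis by simp
  qed
  define U where "U = mat n n (\<lambda>(k,i). ws ! i $ k / complex_of_real (sqrt (r i)))"
  have "mat_adjoint U * U = 1\<^sub>m n"
  proof (rule eq_matI)
    fix i j assume "i < dim_row (1\<^sub>m n)" "j < dim_col (1\<^sub>m n)"
    then have ij: "i < n" "j < n" by auto
    let ?s = "complex_of_real (sqrt (r i)) * complex_of_real (sqrt (r j))"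
    have "(mat_adjoint U * U) $$ (i,j) = (\<Sum>k<n. ws ! j $ k * cnj (ws ! i $ k) / ?s)"
      using ij by (subst mult_mat_index[of _ n n _ n]) (auto simp: U_def mult.commute intro!: sum.cong)
    also have "\<dots> = (ws ! j \<bullet>c ws ! i) / ?s"
      using ij by (simp add: scalar_prod_def sum_divide_distrib lessThan_atLeast0)
    also have "\<dots> = (if i = j then 1 else 0)"
    proof (cases "i = j")
      case True
      have "?s = complex_of_real (sqrt (r i) * sqrt (r i))" using True by (simp only: of_real_mult)
      also have "\<dots> = complex_of_real (r i)" using r[OF ij(1)] by simp
      finally show ?thesis using True sq[OF ij(1)] r[OF ij(1)] by simp
    next
      case False
      then show ?thesis using corthogonalD[OF ws(2), of j i] ij ws(3) by auto
    qed
    finally show "(mat_adjoint U * U) $$ (i,j) = 1\<^sub>m n $$ (i,j)" using ij by simp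
  qed (auto simp: U_def)
  then have "unitary_mat n U" by (simp add: unitary_mat_def U_def)
  moreover have "ws ! 0 = v" using hdws ws(3) n hd_conv_nth[of ws] by force
  then have "col U 0 = (1 / complex_of_real (sqrt (r 0))) \<cdot>\<^sub>v v"
    using n v(1) by (intro eq_vecI) (auto simp: U_def)
  moreover have "1 / complex_of_real (sqrt (r 0)) \<noteq> 0" using r[of 0] n by auto
  ultimately show ?thesis using that by blast
qed

text \<open>Deflation by induction on the dimension. In an orthonormal basis starting with an
  eigenvector, the first column of \<open>A\<close> is a multiple of the first unit vector; by
  symmetry so is the first row, and the remaining block is Hermitian of size
  \<open>n\<close>.\<close>

theorem hermitian_spectral:
  fixes A :: "complex mat"
  assumes "A \<in> carrier_mat n n" "mat_adjoint A = A"
  obtains U and e :: "nat \<Rightarrow> real" where "unitary_mat n U"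
    "A = U * diag_of n (\<lambda>k. complex_of_real (e k)) * mat_adjoint U"
proof -
  have "\<exists>U (e :: nat \<Rightarrow> real). unitary_mat n U \<and>
    A = U * diag_of n (\<lambda>k. complex_of_real (e k)) * mat_adjoint U"
    using assms
  proof (induction n arbitrary: A)
    case 0
    then show ?case by (intro exI[of _ "1\<^sub>m 0"] exI[of _ "\<lambda>_. 0"]) (auto simp: unitary_mat_def)
  next
    case (Suc n)
    let ?N = "Suc n"
    obtain e where "eigenvalue A e"
      using spectrum_non_empty[OF Suc.prems(1)] by (auto simp: spectrum_def)
    then obtain v where "eigenvector A v e" by (auto simp: eigenvalue_def)
    then have v: "v \<in> carrier_vec ?N" "v \<noteq> 0\<^sub>v ?N" and Av: "A *\<^sub>v v = e \<cdot>\<^sub>v v"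
      using Suc.prems by (auto simp: eigenvector_def)
    obtain U c where U: "unitary_mat ?N U" and c: "c \<noteq> 0" "col U 0 = c \<cdot>\<^sub>v v"
      using unitary_completion[OF v] .
    note u = unitary_matD[OF U]
    define B where "B = mat_adjoint U * A * U"
    have Bc: "B \<in> carrier_mat ?N ?N" using u(1,2) Suc.prems(1) by (simp add: B_def square_mult_carrier)
    have Bh: "mat_adjoint B = B" using u(1,2) Suc.prems
      by (simp add: B_def mat_adjoint_mult[of _ ?N ?N _ ?N] assoc_mult_mat[of _ ?N ?N _ ?N _ ?N] square_mult_carrier)
    have "B = mat_adjoint U * (A * U)"
      using u(1,2) Suc.prems(1) by (simp add: B_def assoc_mult_mat[of _ ?N ?N _ ?N _ ?N])
    then have "col B 0 = mat_adjoint U *\<^sub>v col (A * U) 0"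
      using col_mult2[OF u(2) square_mult_carrier[OF Suc.prems(1) u(1)], of 0] by simp
    also have "col (A * U) 0 = A *\<^sub>v col U 0"
      using col_mult2[OF Suc.prems(1) u(1), of 0] by simp
    also have "A *\<^sub>v col U 0 = e \<cdot>\<^sub>v col U 0"
      using v(1) Suc.prems(1) by (simp add: c(2) mult_mat_vec[of _ ?N ?N] Av smult_smult_assoc mult.commute)
    also have "mat_adjoint U *\<^sub>v (e \<cdot>\<^sub>v col U 0) = e \<cdot>\<^sub>v col (mat_adjoint U * U) 0"
      using mult_mat_vec[OF u(2) col_carrier_vec[OF _ u(1)], of 0 e] col_mult2[OF u(2) u(1), of 0] by simp
    finally have col0: "col B 0 = e \<cdot>\<^sub>v unit_vec ?N 0" by (simp add: u(3))
    have B0: "B $$ (i,0) = (if i = 0 then e else 0)" if "i < ?N" for i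
      using arg_cong[OF col0, of "\<lambda>v. v $ i"] that Bc by auto
    have adjB: "B $$ (i,j) = cnj (B $$ (j,i))" if "i < ?N" "j < ?N" for i j
      using arg_cong[OF Bh, of "\<lambda>M. M $$ (i,j)"] that Bc by auto
    define C where "C = mat n n (\<lambda>(i,j). B $$ (Suc i, Suc j))"
    have "mat_adjoint C = C" by (rule eq_matI) (simp_all add: C_def adjB[symmetric])
    then obtain V and f :: "nat \<Rightarrow> real" where V: "unitary_mat n V"
      and Cf: "C = V * diag_of n (\<lambda>k. complex_of_real (f k)) * mat_adjoint V"
      using Suc.IH[of C] by (auto simp: C_def)
    note vv = unitary_matD[OF V]
    \<comment> \<open>The block-diagonal extension of \<open>V\<close> by a leading 1, which leaves
      the eigenvector already split off untouched.\<close>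
    define W where "W = mat ?N ?N (\<lambda>(i,j). if i = 0 \<and> j = 0 then 1 else if i = 0 \<or> j = 0 then 0 else V $$ (i-1,j-1))"
    have Wc: "W \<in> carrier_mat ?N ?N" by (simp add: W_def)
    define g where "g = (\<lambda>k. if k = 0 then Re e else f (k-1))"
    \<comment> \<open>The eigenvalue is a diagonal entry of the Hermitian matrix \<open>B\<close>,
      hence equal to its own conjugate.\<close>
    have e_real: "complex_of_real (Re e) = e"
      using adjB[of 0 0] B0[of 0] by (simp add: complex_eq_iff)
    have W: "unitary_mat ?N W" unfolding unitary_mat_def
    proof (intro conjI Wc eq_matI)
      fix i j assume "i < dim_row (1\<^sub>m ?N)" "j < dim_col (1\<^sub>m ?N)"
      then have ij: "i < ?N" "j < ?N" by auto
      have "(mat_adjoint V * V) $$ (i',j') = (\<Sum>k<n. cnj (V $$ (k,i')) * V $$ (k,j'))" if "i' < n" "j' < n" for i' j'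
        using vv that by (subst mult_mat_index[of _ n n _ n]) auto
      then have "(\<Sum>k<n. cnj (V $$ (k,i')) * V $$ (k,j')) = (if i' = j' then 1 else 0)" if "i' < n" "j' < n" for i' j'
        using that vv(3) by simp
      then show "(mat_adjoint W * W) $$ (i,j) = 1\<^sub>m ?N $$ (i,j)"
        using ij unfolding mult_mat_index[OF mat_adjoint_carrier[OF Wc] Wc ij]
        by (cases i; cases j; auto simp del: sum.lessThan_Suc simp: sum.lessThan_Suc_shift W_def)
    qed (use Wc in auto)
    have BW: "B = W * diag_of ?N (\<lambda>k. complex_of_real (g k)) * mat_adjoint W"
    proof (rule eq_matI)
      fix i j assume "i < dim_row (W * diag_of ?N (\<lambda>k. complex_of_real (g k)) * mat_adjoint W)"
        "j < dim_col (W * diag_of ?N (\<lambda>k. complex_of_real (g k)) * mat_adjoint W)"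
      then have ij: "i < ?N" "j < ?N" using Wc by auto
      have gen: "(P * diag_of m d * mat_adjoint P) $$ (i,j) = (\<Sum>k<m. P $$ (i,k) * d k * cnj (P $$ (j,k)))"
        if "P \<in> carrier_mat m m" "i < m" "j < m" for P m d i j
      proof -
        have "(P * diag_of m d) $$ (i,k) = P $$ (i,k) * d k" if "k < m" for k
          using that \<open>P \<in> carrier_mat m m\<close> \<open>i < m\<close>
          by (subst mult_mat_index[of _ m m _ m]) (auto simp: if_distrib cong: if_cong)
        then show ?thesis using that by (subst mult_mat_index[of _ m m _ m]) auto
      qed
      have CV: "(\<Sum>k<n. V $$ (i',k) * complex_of_real (f k) * cnj (V $$ (j',k))) = B $$ (Suc i', Suc j')" if "i' < n" "j' < n" for i' j'
        using arg_cong[OF Cf, of "\<lambda>M. M $$ (i',j')"] that gen[OF vv(1)] by (simp add: C_def)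
      have B0': "B $$ (0, Suc j') = 0" if "j' < n" for j' using adjB[of 0 "Suc j'"] B0[of "Suc j'"] that by simp
      show "B $$ (i,j) = (W * diag_of ?N (\<lambda>k. complex_of_real (g k)) * mat_adjoint W) $$ (i,j)"
        unfolding gen[OF Wc ij] using ij e_real B0 B0'
        by (cases i; cases j)
          (auto simp del: sum.lessThan_Suc simp: sum.lessThan_Suc_shift W_def g_def CV)
    qed (use Wc Bc in auto)
    have "A = (U * mat_adjoint U) * A * (U * mat_adjoint U)" using u(4) Suc.prems by simp
    also have "\<dots> = U * B * mat_adjoint U"
      using u(1,2) Suc.prems(1) by (simp add: B_def assoc_mult_mat[of _ ?N ?N _ ?N _ ?N] square_mult_carrier)
    also have "\<dots> = (U * W) * diag_of ?N (\<lambda>k. complex_of_real (g k)) * mat_adjoint (U * W)"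
      using u(1,2) Wc by (simp add: BW mat_adjoint_mult[of _ ?N ?N _ ?N] assoc_mult_mat[of _ ?N ?N _ ?N _ ?N] square_mult_carrier)
    finally show ?case using unitary_mat_mult[OF U W] by blast
  qed
  then show ?thesis using that by blast
qed

section \<open>Threshold measurements of an observable\<close>

lemma adjoint_scalar_prod:
  fixes A :: "complex mat"
  assumes "A \<in> carrier_mat m n" "v \<in> carrier_vec n" "w \<in> carrier_vec m"
  shows "(mat_adjoint A *\<^sub>v w) \<bullet>c v = w \<bullet>c (A *\<^sub>v v)"
proof -
  have "(mat_adjoint A *\<^sub>v w) \<bullet>c v = (\<Sum>j<n. \<Sum>k<m. cnj (A $$ (k,j)) * w $ k * cnj (v $ j))"
    using assms by (auto simp: scalar_prod_def lessThan_atLeast0 sum_distrib_right intro!: sum.cong)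
  also have "\<dots> = (\<Sum>k<m. \<Sum>j<n. cnj (A $$ (k,j)) * w $ k * cnj (v $ j))" by (rule sum.swap)
  also have "\<dots> = w \<bullet>c (A *\<^sub>v v)"
    using assms by (auto simp: scalar_prod_def lessThan_atLeast0 sum_distrib_left intro!: sum.cong)
  finally show ?thesis .
qed

lemma self_scalar_prod_Re_nonneg: "0 \<le> Re ((v :: complex vec) \<bullet>c v)"
  by (auto simp: scalar_prod_def intro!: sum_nonneg add_nonneg_nonneg)

text \<open>The quadratic form at \<open>v\<close> is the squared length of
  \<open>B *\<^sub>v v\<close>.\<close>

lemma psd_gram:
  assumes "B \<in> carrier_mat m n"
  shows "psd n (mat_adjoint B * B)"
  unfolding psd_def
proof (intro conjI ballI)
  show "mat_adjoint B * B \<in> carrier_mat n n" using assms by (intro mult_carrier_mat[of _ n m]) auto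
  show "mat_adjoint (mat_adjoint B * B) = mat_adjoint B * B"
    using assms by (simp add: mat_adjoint_mult[of _ n m _ n])
  fix v :: "complex vec" assume v: "v \<in> carrier_vec n"
  have "(mat_adjoint B * B *\<^sub>v v) \<bullet>c v = (B *\<^sub>v v) \<bullet>c (B *\<^sub>v v)"
    using assms v by (simp add: assoc_mult_mat_vec[of _ n m _ n] adjoint_scalar_prod[of _ m n])
  then show "0 \<le> Re ((mat_adjoint B * B *\<^sub>v v) \<bullet>c v)"
    by (simp add: self_scalar_prod_Re_nonneg)
qed

text \<open>Links diagonal entries in a new basis to the quadratic form that \<open>psd\<close>
  speaks about; eigenvalues and outcome probabilities both get their sign this way.\<close>

lemma conjugation_diag_index:
  fixes A U :: "complex mat"
  assumes "A \<in> carrier_mat n n" "U \<in> carrier_mat n n" "k < n"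
  shows "(mat_adjoint U * A * U) $$ (k,k) = (A *\<^sub>v col U k) \<bullet>c col U k"
proof -
  have "(mat_adjoint U * A * U) $$ (k,k) = (mat_adjoint U * (A * U)) $$ (k,k)"
    using assms by (simp add: assoc_mult_mat[of _ n n _ n _ n])
  also have "\<dots> = (\<Sum>i<n. cnj (U $$ (i,k)) * (A * U) $$ (i,k))"
    using assms by (subst mult_mat_index[of _ n n _ n]) auto
  also have "\<dots> = (A *\<^sub>v col U k) \<bullet>c col U k"
    using assms by (auto simp: scalar_prod_def[of _ "conjugate _"] lessThan_atLeast0 mult.commute intro!: sum.cong)
  finally show ?thesis .
qed

lemma psd_conjugation_diag_nonneg:
  assumes "psd n A" "U \<in> carrier_mat n n" "k < n"
  shows "0 \<le> Re ((mat_adjoint U * A * U) $$ (k,k))"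
proof -
  have "col U k \<in> carrier_vec n" using assms by auto
  with assms show ?thesis unfolding psd_def by (subst conjugation_diag_index) auto
qed

lemma unitary_diagonalize:
  assumes U: "unitary_mat n U"
  shows "mat_adjoint U * (U * diag_of n e * mat_adjoint U) * U = diag_of n e"
proof -
  note u = unitary_matD[OF U]
  have "mat_adjoint U * (U * diag_of n e * mat_adjoint U) * U
      = (mat_adjoint U * U) * diag_of n e * (mat_adjoint U * U)"
    using u(1,2) by (simp add: assoc_mult_mat[of _ n n _ n _ n] square_mult_carrier)
  then show ?thesis by (simp add: u(3) right_mult_one_mat[of _ n n] left_mult_one_mat[of _ n n])
qed

text \<open>\<open>B\<close> is a square root of the matrix up to a unitary: the diagonal factor
  splits into two copies of its entrywise root.\<close>

lemma nonneg_diag_gram: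
  assumes U: "unitary_mat n U" and e: "\<And>k. k < n \<Longrightarrow> 0 \<le> e k"
  defines "B \<equiv> diag_of n (\<lambda>k. complex_of_real (sqrt (e k))) * mat_adjoint U"
  shows "U * diag_of n (\<lambda>k. complex_of_real (e k)) * mat_adjoint U = mat_adjoint B * B"
proof -
  note u = unitary_matD[OF U]
  let ?S = "diag_of n (\<lambda>k. complex_of_real (sqrt (e k)))"
  have "diag_of n (\<lambda>k. complex_of_real (e k)) = ?S * ?S"
    unfolding diag_of_mult by (rule eq_matI) (auto simp: e simp flip: of_real_mult)
  moreover have "mat_adjoint B = U * ?S"
    using u(1,2) by (simp add: B_def mat_adjoint_mult[of _ n n _ n] diag_of_adjoint)
  ultimately show ?thesis
    using u(1,2) by (simp add: B_def assoc_mult_mat[of _ n n _ n _ n] square_mult_carrier)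
qed

lemma psd_unitary_diag:
  assumes U: "unitary_mat n U" and e: "\<And>k. k < n \<Longrightarrow> 0 \<le> e k"
  shows "psd n (U * diag_of n (\<lambda>k. complex_of_real (e k)) * mat_adjoint U)"
  using unitary_matD(2)[OF U]
  by (subst nonneg_diag_gram[OF U e]) (auto intro!: psd_gram[of _ n] square_mult_carrier)

text \<open>The eigenvalues are diagonal entries after conjugation by \<open>U\<close>, hence
  nonnegative and with real square roots. The Gram form yields positivity of tensor products and the
  purity bound for states.\<close>

lemma psd_obtain_gram:
  assumes "psd n A"
  obtains B where "B \<in> carrier_mat n n" "A = mat_adjoint B * B"
proof -
  obtain U and e :: "nat \<Rightarrow> real" where U: "unitary_mat n U"
    and A: "A = U * diag_of n (\<lambda>k. complex_of_real (e k)) * mat_adjoint U"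
    using hermitian_spectral[of A n] assms unfolding psd_def by blast
  have "0 \<le> e k" if "k < n" for k
    using psd_conjugation_diag_nonneg[OF assms unitary_matD(1)[OF U] that] that
    unfolding A unitary_diagonalize[OF U] by simp
  then show ?thesis
    using that nonneg_diag_gram[OF U, of e] unitary_matD(2)[OF U] A
    by (metis square_mult_carrier diag_of_carrier)
qed

section \<open>Traces in an eigenbasis and tail probabilities\<close>

lemma mtrace_comm:
  assumes "A \<in> carrier_mat m n" "B \<in> carrier_mat n m"
  shows "mtrace (A * B) = mtrace (B * A)"
proof -
  have "mtrace (A * B) = (\<Sum>i<m. \<Sum>k<n. A $$ (i,k) * B $$ (k,i))"
    using assms by (auto simp: mtrace_def mult_mat_index[of _ m n _ m] simp del: index_mult_mat(1) intro!: sum.cong)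
  also have "\<dots> = (\<Sum>k<n. \<Sum>i<m. A $$ (i,k) * B $$ (k,i))" by (rule sum.swap)
  also have "\<dots> = mtrace (B * A)"
    using assms by (auto simp: mtrace_def mult_mat_index[of _ n m _ n] mult.commute simp del: index_mult_mat(1) intro!: sum.cong)
  finally show ?thesis .
qed

lemma mtrace_diag_mult:
  assumes "A \<in> carrier_mat n n"
  shows "mtrace (diag_of n f * A) = (\<Sum>k<n. f k * A $$ (k,k))"
proof -
  have "(diag_of n f * A) $$ (k,k) = (\<Sum>i<n. if i = k then f k * A $$ (k,k) else 0)" if "k < n" for k
    unfolding mult_mat_index[OF diag_of_carrier assms that that]
    using that by (intro sum.cong) auto
  then show ?thesis using assms by (simp add: mtrace_def)
qed

text \<open>By cyclicity of the trace. The weights on the right do not depend on \<open>f\<close>,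
  so the mean, second moment and acceptance probability become sums over one distribution.\<close>

lemma mtrace_spectral:
  assumes U: "unitary_mat n U" and R: "R \<in> carrier_mat n n"
  shows "mtrace (U * diag_of n f * mat_adjoint U * R) = (\<Sum>k<n. f k * (mat_adjoint U * R * U) $$ (k,k))"
proof -
  note u = unitary_matD(1,2)[OF U]
  have "mtrace (U * diag_of n f * mat_adjoint U * R) = mtrace (U * (diag_of n f * mat_adjoint U * R))"
    using u R by (simp add: assoc_mult_mat[of _ n n _ n _ n] square_mult_carrier)
  also have "\<dots> = mtrace (diag_of n f * mat_adjoint U * R * U)"
    using u R by (intro mtrace_comm[of _ n n]) (auto intro!: square_mult_carrier)
  also have "\<dots> = mtrace (diag_of n f * (mat_adjoint U * R * U))"
    using u R by (simp add: assoc_mult_mat[of _ n n _ n _ n] square_mult_carrier)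
  also have "\<dots> = (\<Sum>k<n. f k * (mat_adjoint U * R * U) $$ (k,k))"
    using u R by (intro mtrace_diag_mult square_mult_carrier)
  finally show ?thesis .
qed

text \<open>Chebyshev's inequality for the value \<open>e k\<close> taken with probability
  \<open>q k\<close>: \<open>s\<close> squared times the indicator of \<open>P\<close> is dominated
  by the squared deviation from the mean. \<open>P\<close> may be either tail.\<close>

lemma chebyshev_finite:
  fixes e q :: "nat \<Rightarrow> real"
  assumes q: "\<And>k. k < n \<Longrightarrow> 0 \<le> q k" and one: "(\<Sum>k<n. q k) = 1"
  defines "m \<equiv> (\<Sum>k<n. e k * q k)"
  assumes P: "\<And>k. k < n \<Longrightarrow> P k \<Longrightarrow> s \<le> \<bar>e k - m\<bar>" and s: "s > 0"
  shows "(\<Sum>k<n. of_bool (P k) * q k) \<le> ((\<Sum>k<n. (e k)\<^sup>2 * q k) - m\<^sup>2) / s\<^sup>2"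
proof -
  have "s\<^sup>2 * (\<Sum>k<n. of_bool (P k) * q k) \<le> (\<Sum>k<n. (e k - m)\<^sup>2 * q k)"
    unfolding sum_distrib_left
  proof (intro sum_mono)
    fix k assume k: "k \<in> {..<n}"
    show "s\<^sup>2 * (of_bool (P k) * q k) \<le> (e k - m)\<^sup>2 * q k"
    proof (cases "P k")
      case True
      then have "s\<^sup>2 \<le> (e k - m)\<^sup>2" using P[of k] k s by (simp add: abs_le_square_iff[symmetric])
      then show ?thesis using q[of k] k True by (simp add: mult_right_mono)
    qed (use q[of k] k in simp)
  qed
  also have "\<dots> = (\<Sum>k<n. (e k)\<^sup>2 * q k - 2 * m * (e k * q k) + m\<^sup>2 * q k)"
    by (intro sum.cong) (auto simp: algebra_simps power2_eq_square)
  also have "\<dots> = (\<Sum>k<n. (e k)\<^sup>2 * q k) - 2 * m * m + m\<^sup>2 * 1"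
    unfolding sum.distrib sum_subtractf sum_distrib_left[symmetric] one by (simp add: m_def)
  finally show ?thesis using s by (simp add: pos_le_divide_eq power2_eq_square mult.commute)
qed

text \<open>\<open>M\<close> is the spectral projection of \<open>Y\<close> onto eigenvalues at most
  \<open>r\<close>. When the mean lies on one side of \<open>r\<close>, a wrong answer forces a
  deviation of at least the distance from the mean to \<open>r\<close>.\<close>

theorem threshold_measurement:
  assumes Y: "Y \<in> carrier_mat n n" "mat_adjoint Y = Y"
  obtains M where "two_outcome_povm n M"
    "\<And>R. psd n R \<Longrightarrow> mtrace R = 1 \<Longrightarrow> Re (mtrace (Y * R)) < r \<Longrightarrow>
       1 - accept_prob M R \<le> (Re (mtrace (Y * Y * R)) - (Re (mtrace (Y * R)))\<^sup>2) / (r - Re (mtrace (Y * R)))\<^sup>2"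
    "\<And>R. psd n R \<Longrightarrow> mtrace R = 1 \<Longrightarrow> r < Re (mtrace (Y * R)) \<Longrightarrow>
       accept_prob M R \<le> (Re (mtrace (Y * Y * R)) - (Re (mtrace (Y * R)))\<^sup>2) / (Re (mtrace (Y * R)) - r)\<^sup>2"
proof -
  obtain U and e :: "nat \<Rightarrow> real" where U: "unitary_mat n U"
    and Ye: "Y = U * diag_of n (\<lambda>k. complex_of_real (e k)) * mat_adjoint U"
    using hermitian_spectral[OF Y] by blast
  note u = unitary_matD[OF U]
  \<comment> \<open>\<open>F f\<close> is the function \<open>f\<close> applied to \<open>Y\<close>
    in the sense of functional calculus.\<close>
  define F where "F f = U * diag_of n (\<lambda>k. complex_of_real (f k)) * mat_adjoint U" for f :: "nat \<Rightarrow> real"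
  have F1: "F (\<lambda>_. 1) = 1\<^sub>m n"
  proof -
    have "diag_of n (\<lambda>_. 1) = 1\<^sub>m n" by (rule eq_matI) auto
    then show ?thesis using u by (simp add: F_def)
  qed
  have Fc: "F f \<in> carrier_mat n n" for f using u by (auto simp: F_def intro!: square_mult_carrier)
  have Fd: "F f - F g = F (\<lambda>k. f k - g k)" for f g
  proof -
    have "diag_of n (\<lambda>k. complex_of_real (f k - g k))
        = diag_of n (\<lambda>k. complex_of_real (f k)) - diag_of n (\<lambda>k. complex_of_real (g k))"
      by (rule eq_matI) auto
    then show ?thesis using u(1,2)
      by (simp add: F_def mult_minus_distrib_mat[of _ n n _ n] minus_mult_distrib_mat[of _ n n _ _ n] square_mult_carrier)
  qed
  have YY: "Y * Y = F (\<lambda>k. (e k)\<^sup>2)"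
  proof -
    have "Y * Y = U * diag_of n (\<lambda>k. complex_of_real (e k)) * (mat_adjoint U * U) *
        diag_of n (\<lambda>k. complex_of_real (e k)) * mat_adjoint U"
      using u(1,2) by (simp add: Ye assoc_mult_mat[of _ n n _ n _ n] square_mult_carrier)
    also have "\<dots> = U * (diag_of n (\<lambda>k. complex_of_real (e k)) * diag_of n (\<lambda>k. complex_of_real (e k))) * mat_adjoint U"
      using u by (simp add: right_mult_one_mat[of _ n n] assoc_mult_mat[of _ n n _ n _ n] square_mult_carrier)
    finally show ?thesis by (simp add: F_def diag_of_mult power2_eq_square)
  qed
  define M where "M = F (\<lambda>k. of_bool (e k \<le> r))"
  \<comment> \<open>The complement of \<open>M\<close> is \<open>F\<close> of the complementary
    indicator, so both effects have eigenvalues in {0, 1}.\<close>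
  have povm: "two_outcome_povm n M"
    unfolding two_outcome_povm_def M_def F1[symmetric] Fd
    unfolding F_def by (intro conjI psd_unitary_diag[OF U]) auto
  \<comment> \<open>The Born weights: the distribution of the eigenvalue index when \<open>Y\<close>
    is measured in the state \<open>R\<close>.\<close>
  define q where "q R k = Re ((mat_adjoint U * R * U) $$ (k,k))" for R k
  have tr: "Re (mtrace (F f * R)) = (\<Sum>k<n. f k * q R k)" if "psd n R" for f R
    using that by (simp add: F_def q_def mtrace_spectral[OF U] psd_def)
  have q0: "0 \<le> q R k" if "psd n R" "k < n" for R k
    unfolding q_def using psd_conjugation_diag_nonneg[OF that(1) u(1) that(2)] .
  have q1: "(\<Sum>k<n. q R k) = 1" if "psd n R" "mtrace R = 1" for R
    using tr[OF that(1), of "\<lambda>_. 1"] that by (simp add: F1 psd_def left_mult_one_mat[of _ n n])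
  have YF: "Y = F e" by (simp add: Ye F_def)
  have m1: "Re (mtrace (Y * R)) = (\<Sum>k<n. e k * q R k)" if "psd n R" for R
    unfolding YF tr[OF that] ..
  have m2: "Re (mtrace (Y * Y * R)) = (\<Sum>k<n. (e k)\<^sup>2 * q R k)" if "psd n R" for R
    unfolding YY tr[OF that] ..
  have acc: "accept_prob M R = (\<Sum>k<n. of_bool (e k \<le> r) * q R k)" if "psd n R" for R
    unfolding accept_prob_def M_def tr[OF that] ..
  have rej: "1 - accept_prob M R = (\<Sum>k<n. of_bool (r < e k) * q R k)" if "psd n R" "mtrace R = 1" for R
    unfolding acc[OF that(1)] q1[OF that, symmetric] sum_subtractf[symmetric]
    by (intro sum.cong) auto
  show ?thesis
  proof (rule that[OF povm])
    fix R assume R: "psd n R" "mtrace R = 1"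
    { assume "Re (mtrace (Y * R)) < r"
      then show "1 - accept_prob M R \<le> (Re (mtrace (Y * Y * R)) - (Re (mtrace (Y * R)))\<^sup>2) / (r - Re (mtrace (Y * R)))\<^sup>2"
        unfolding rej[OF R] m1[OF R(1)] m2[OF R(1)]
        by (intro chebyshev_finite q0 q1 R) auto }
    { assume "r < Re (mtrace (Y * R))"
      then show "accept_prob M R \<le> (Re (mtrace (Y * Y * R)) - (Re (mtrace (Y * R)))\<^sup>2) / (Re (mtrace (Y * R)) - r)\<^sup>2"
        unfolding acc[OF R(1)] m1[OF R(1)] m2[OF R(1)]
        by (intro chebyshev_finite q0 q1 R) auto }
  qed
qed

section \<open>Tensor products\<close>

lemma div_mod_bounds:
  fixes i :: nat assumes "i < a*c" shows "i div c < a" "i mod c < c"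
  using assms by (cases "c = 0"; auto simp: less_mult_imp_div_less)+

text \<open>A row or column index of a Kronecker product encodes a pair as \<open>i * n + j\<close>;
  quotient and remainder decode it.\<close>

lemma sum_div_mod:
  fixes f :: "nat \<Rightarrow> nat \<Rightarrow> 'a::comm_monoid_add"
  shows "(\<Sum>k<m*n. f (k div n) (k mod n)) = (\<Sum>i<m. \<Sum>j<n. f i j)"
proof -
  have bound: "i * n + j < m * n" if "i < m" "j < n" for i j
  proof -
    have "i * n + j < Suc i * n" using that by simp
    also have "\<dots> \<le> m * n" using that by (intro mult_right_mono) auto
    finally show ?thesis .
  qed
  have "(\<Sum>k<m*n. f (k div n) (k mod n)) = (\<Sum>(i,j)\<in>{..<m}\<times>{..<n}. f i j)"
    by (rule sum.reindex_bij_witness[of _ "\<lambda>(i,j). i*n+j" "\<lambda>k. (k div n, k mod n)"])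
      (auto simp: div_mod_bounds bound)
  then show ?thesis by (simp add: sum.cartesian_product)
qed

lemma kron_carrier:
  "A \<in> carrier_mat a b \<Longrightarrow> B \<in> carrier_mat c e \<Longrightarrow> kron A B \<in> carrier_mat (a*c) (b*e)"
  by (simp add: kron_def)

lemma kron_index:
  assumes "A \<in> carrier_mat a b" "B \<in> carrier_mat c e" "i < a*c" "j < b*e"
  shows "kron A B $$ (i,j) = A $$ (i div c, j div e) * B $$ (i mod c, j mod e)"
  using assms by (simp add: kron_def)

text \<open>The mixed-product rule: the summation index splits into a pair, and the double sum
  factorizes.\<close>

lemma kron_mult:
  assumes A: "A \<in> carrier_mat a b" and B: "B \<in> carrier_mat b c"
    and C: "C \<in> carrier_mat a' b'" and D: "D \<in> carrier_mat b' c'"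
  shows "kron A C * kron B D = kron (A * B) (C * D)"
proof (rule eq_matI)
  note AB = mult_carrier_mat[OF A B] and CD = mult_carrier_mat[OF C D]
  have carr: "kron (A * B) (C * D) \<in> carrier_mat (a*a') (c*c')" by (rule kron_carrier[OF AB CD])
  note AC = kron_carrier[OF A C] and BD = kron_carrier[OF B D]
  show "dim_row (kron A C * kron B D) = dim_row (kron (A * B) (C * D))"
    "dim_col (kron A C * kron B D) = dim_col (kron (A * B) (C * D))" using AC BD carr by auto
  fix i j assume "i < dim_row (kron (A * B) (C * D))" "j < dim_col (kron (A * B) (C * D))"
  then have ij: "i < a*a'" "j < c*c'" using carr by auto
  note di = div_mod_bounds[OF ij(1)] and dj = div_mod_bounds[OF ij(2)]
  have "(kron A C * kron B D) $$ (i,j) = (\<Sum>k<b*b'. A $$ (i div a', k div b') * C $$ (i mod a', k mod b') *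
      (B $$ (k div b', j div c') * D $$ (k mod b', j mod c')))"
    unfolding mult_mat_index[OF AC BD ij]
    by (intro sum.cong refl) (use ij in \<open>simp add: kron_index[OF A C] kron_index[OF B D]\<close>)
  also have "\<dots> = (\<Sum>k<b. \<Sum>l<b'. A $$ (i div a', k) * C $$ (i mod a', l) *
      (B $$ (k, j div c') * D $$ (l, j mod c')))"
    by (rule sum_div_mod)
  also have "\<dots> = (\<Sum>k<b. A $$ (i div a', k) * B $$ (k, j div c')) * (\<Sum>l<b'. C $$ (i mod a', l) * D $$ (l, j mod c'))"
    by (simp add: sum_product mult.commute mult.left_commute)
  also have "\<dots> = kron (A * B) (C * D) $$ (i,j)"
    unfolding kron_index[OF AB CD ij] mult_mat_index[OF A B di(1) dj(1)] mult_mat_index[OF C D di(2) dj(2)] ..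
  finally show "(kron A C * kron B D) $$ (i,j) = kron (A * B) (C * D) $$ (i,j)" .
qed

lemma mat_adjoint_kron: "mat_adjoint (kron A B) = kron (mat_adjoint A) (mat_adjoint B)"
  by (rule eq_matI) (auto simp: kron_def div_mod_bounds)

lemma mtrace_kron:
  assumes A: "A \<in> carrier_mat a a" and B: "B \<in> carrier_mat b b"
  shows "mtrace (kron A B) = mtrace A * mtrace B"
proof -
  have "mtrace (kron A B) = (\<Sum>i<a*b. A $$ (i div b, i div b) * B $$ (i mod b, i mod b))"
    using kron_carrier[OF A B] by (auto simp: mtrace_def kron_index[OF A B] intro!: sum.cong)
  also have "\<dots> = (\<Sum>i<a. \<Sum>j<b. A $$ (i,i) * B $$ (j,j))" by (rule sum_div_mod)
  finally show ?thesis using A B by (simp add: mtrace_def sum_product)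
qed

text \<open>Factors are addressed by position, so an operator acting on a few of them can be given
  pointwise, with identities elsewhere.\<close>

definition tens :: "nat \<Rightarrow> (nat \<Rightarrow> complex mat) \<Rightarrow> complex mat" where
  "tens n f = tensor_list (map f [0..<n])"

lemma tensor_list_carrier:
  "(\<And>k. k \<in> set xs \<Longrightarrow> f k \<in> carrier_mat d d) \<Longrightarrow>
    tensor_list (map f xs) \<in> carrier_mat (d ^ length xs) (d ^ length xs)"
  by (induction xs) (auto intro!: kron_carrier)

lemma tensor_list_mult:
  "(\<And>k. k \<in> set xs \<Longrightarrow> f k \<in> carrier_mat d d) \<Longrightarrow> (\<And>k. k \<in> set xs \<Longrightarrow> g k \<in> carrier_mat d d) \<Longrightarrow>
    tensor_list (map f xs) * tensor_list (map g xs) = tensor_list (map (\<lambda>k. f k * g k) xs)"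
proof (induction xs)
  case (Cons x xs)
  have "kron (f x) (tensor_list (map f xs)) * kron (g x) (tensor_list (map g xs)) =
      kron (f x * g x) (tensor_list (map f xs) * tensor_list (map g xs))"
    using Cons.prems
    by (intro kron_mult[of _ d d _ d _ "d ^ length xs" "d ^ length xs" _ "d ^ length xs"] tensor_list_carrier) auto
  then show ?case using Cons by simp
qed simp

lemma tensor_list_adjoint:
  "mat_adjoint (tensor_list (map f xs)) = tensor_list (map (\<lambda>k. mat_adjoint (f k)) xs)"
  by (induction xs) (auto simp: mat_adjoint_kron)

lemma tensor_list_mtrace:
  "(\<And>k. k \<in> set xs \<Longrightarrow> f k \<in> carrier_mat d d) \<Longrightarrow>
    mtrace (tensor_list (map f xs)) = prod_list (map (\<lambda>k. mtrace (f k)) xs)"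
proof (induction xs)
  case (Cons x xs)
  have "mtrace (kron (f x) (tensor_list (map f xs))) = mtrace (f x) * mtrace (tensor_list (map f xs))"
    using Cons.prems by (intro mtrace_kron[of _ d _ "d ^ length xs"] tensor_list_carrier) auto
  then show ?case using Cons by simp
qed (simp add: mtrace_def)

lemma tens_carrier:
  "(\<And>k. k < n \<Longrightarrow> f k \<in> carrier_mat d d) \<Longrightarrow> tens n f \<in> carrier_mat (d ^ n) (d ^ n)"
  unfolding tens_def using tensor_list_carrier[of "[0..<n]" f d] by simp

lemma tens_mult:
  "(\<And>k. k < n \<Longrightarrow> f k \<in> carrier_mat d d) \<Longrightarrow> (\<And>k. k < n \<Longrightarrow> g k \<in> carrier_mat d d) \<Longrightarrow>
    tens n f * tens n g = tens n (\<lambda>k. f k * g k)"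
  unfolding tens_def by (rule tensor_list_mult) auto

lemma tens_adjoint: "mat_adjoint (tens n f) = tens n (\<lambda>k. mat_adjoint (f k))"
  by (simp add: tens_def tensor_list_adjoint)

lemma tens_mtrace:
  "(\<And>k. k < n \<Longrightarrow> f k \<in> carrier_mat d d) \<Longrightarrow> mtrace (tens n f) = (\<Prod>k<n. mtrace (f k))"
  unfolding tens_def by (subst tensor_list_mtrace) (auto simp: prod.distinct_set_conv_list[of "[0..<n]", symmetric] lessThan_atLeast0)

lemma tens_cong: "(\<And>k. k < n \<Longrightarrow> f k = g k) \<Longrightarrow> tens n f = tens n g"
  unfolding tens_def by (intro arg_cong[of _ _ tensor_list] map_cong) auto

text \<open>If every factor is a Gram matrix, the tensor product is the Gram matrix of the tensor
  product of the roots.\<close>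

lemma psd_tens:
  assumes "\<And>k. k < n \<Longrightarrow> psd d (f k)"
  shows "psd (d ^ n) (tens n f)"
proof -
  have "\<exists>B. B \<in> carrier_mat d d \<and> f k = mat_adjoint B * B" if "k < n" for k
    using psd_obtain_gram[OF assms[OF that]] by blast
  then obtain B where B: "\<And>k. k < n \<Longrightarrow> B k \<in> carrier_mat d d \<and> f k = mat_adjoint (B k) * B k"
    by metis
  have "tens n f = tens n (\<lambda>k. mat_adjoint (B k) * B k)" using B by (intro tens_cong) auto
  also have "\<dots> = mat_adjoint (tens n B) * tens n B"
    using B by (subst tens_adjoint, subst tens_mult[of n _ d]) auto
  finally show ?thesis using psd_gram[OF tens_carrier[of n B d]] B by simp
qed

definition joint_fun :: "nat \<Rightarrow> (nat \<Rightarrow> 'a) \<Rightarrow> (nat \<Rightarrow> 'a) \<Rightarrow> nat \<Rightarrow> 'a" where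
  "joint_fun T f g k = (if k < T then f k else g (k - T))"

lemma joint_state_eq_tens: "joint_state T \<rho> \<sigma> = tens (2*T) (joint_fun T \<rho> \<sigma>)"
proof -
  have "map \<rho> [0..<T] @ map \<sigma> [0..<T] = map (joint_fun T \<rho> \<sigma>) [0..<2*T]"
    by (rule nth_equalityI) (auto simp: nth_append joint_fun_def)
  then show ?thesis by (simp add: joint_state_def tens_def)
qed

section \<open>Linear combinations of operators\<close>

text \<open>Summing entrywise fixes the size as \<open>N\<close> by \<open>N\<close> whatever the
  index set, the empty one included.\<close>

definition lincomb_mat :: "nat \<Rightarrow> 'i set \<Rightarrow> ('i \<Rightarrow> complex) \<Rightarrow> ('i \<Rightarrow> complex mat) \<Rightarrow> complex mat" where
  "lincomb_mat N J c A = mat N N (\<lambda>(x,y). \<Sum>p\<in>J. c p * A p $$ (x,y))"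

lemma lincomb_mat_carrier [simp]: "lincomb_mat N J c A \<in> carrier_mat N N"
  by (simp add: lincomb_mat_def)

lemma lincomb_mat_mult_right:
  assumes A: "\<And>p. p \<in> J \<Longrightarrow> A p \<in> carrier_mat N N" and R: "R \<in> carrier_mat N N"
  shows "lincomb_mat N J c A * R = lincomb_mat N J c (\<lambda>p. A p * R)"
proof (rule eq_matI)
  fix i j assume "i < dim_row (lincomb_mat N J c (\<lambda>p. A p * R))" "j < dim_col (lincomb_mat N J c (\<lambda>p. A p * R))"
  then have ij: "i < N" "j < N" by (auto simp: lincomb_mat_def)
  have "(lincomb_mat N J c A * R) $$ (i,j) = (\<Sum>k<N. \<Sum>p\<in>J. c p * A p $$ (i,k) * R $$ (k,j))"
    unfolding mult_mat_index[OF lincomb_mat_carrier R ij]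
    using ij by (intro sum.cong) (auto simp: lincomb_mat_def sum_distrib_right)
  also have "\<dots> = (\<Sum>p\<in>J. \<Sum>k<N. c p * A p $$ (i,k) * R $$ (k,j))" by (rule sum.swap)
  also have "\<dots> = (\<Sum>p\<in>J. c p * (A p * R) $$ (i,j))"
    by (intro sum.cong refl) (simp add: mult_mat_index[OF A R ij] sum_distrib_left mult.assoc del: index_mult_mat(1))
  finally show "(lincomb_mat N J c A * R) $$ (i,j) = lincomb_mat N J c (\<lambda>p. A p * R) $$ (i,j)"
    using ij by (simp add: lincomb_mat_def del: index_mult_mat(1))
qed (use R in \<open>auto simp: lincomb_mat_def\<close>)

lemma lincomb_mat_mult_left:
  assumes A: "\<And>p. p \<in> J \<Longrightarrow> A p \<in> carrier_mat N N" and R: "R \<in> carrier_mat N N"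
  shows "R * lincomb_mat N J c A = lincomb_mat N J c (\<lambda>p. R * A p)"
proof (rule eq_matI)
  fix i j assume "i < dim_row (lincomb_mat N J c (\<lambda>p. R * A p))" "j < dim_col (lincomb_mat N J c (\<lambda>p. R * A p))"
  then have ij: "i < N" "j < N" by (auto simp: lincomb_mat_def)
  have "(R * lincomb_mat N J c A) $$ (i,j) = (\<Sum>k<N. \<Sum>p\<in>J. c p * (R $$ (i,k) * A p $$ (k,j)))"
    unfolding mult_mat_index[OF R lincomb_mat_carrier ij]
    using ij by (intro sum.cong) (auto simp: lincomb_mat_def sum_distrib_left algebra_simps)
  also have "\<dots> = (\<Sum>p\<in>J. \<Sum>k<N. c p * (R $$ (i,k) * A p $$ (k,j)))" by (rule sum.swap)
  also have "\<dots> = (\<Sum>p\<in>J. c p * (R * A p) $$ (i,j))"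
    by (intro sum.cong refl) (simp add: mult_mat_index[OF R A ij] sum_distrib_left mult.assoc del: index_mult_mat(1))
  finally show "(R * lincomb_mat N J c A) $$ (i,j) = lincomb_mat N J c (\<lambda>p. R * A p) $$ (i,j)"
    using ij by (simp add: lincomb_mat_def del: index_mult_mat(1))
qed (use R in \<open>auto simp: lincomb_mat_def\<close>)

lemma mtrace_lincomb_mat:
  assumes A: "\<And>p. p \<in> J \<Longrightarrow> A p \<in> carrier_mat N N"
  shows "mtrace (lincomb_mat N J c A) = (\<Sum>p\<in>J. c p * mtrace (A p))"
proof -
  have "mtrace (lincomb_mat N J c A) = (\<Sum>i<N. \<Sum>p\<in>J. c p * A p $$ (i,i))"
    by (auto simp: mtrace_def lincomb_mat_def)
  also have "\<dots> = (\<Sum>p\<in>J. \<Sum>i<N. c p * A p $$ (i,i))" by (rule sum.swap)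
  also have "\<dots> = (\<Sum>p\<in>J. c p * mtrace (A p))"
    using A by (intro sum.cong) (auto simp: mtrace_def sum_distrib_left)
  finally show ?thesis .
qed

lemma mtrace_lincomb_mult:
  assumes A: "\<And>p. p \<in> J \<Longrightarrow> A p \<in> carrier_mat N N" and R: "R \<in> carrier_mat N N"
  shows "mtrace (lincomb_mat N J c A * R) = (\<Sum>p\<in>J. c p * mtrace (A p * R))"
  using A R by (simp add: lincomb_mat_mult_right mtrace_lincomb_mat square_mult_carrier)

lemma mtrace_lincomb_mult2:
  assumes A: "\<And>p. p \<in> J \<Longrightarrow> A p \<in> carrier_mat N N" and R: "R \<in> carrier_mat N N"
  shows "mtrace (lincomb_mat N J c A * lincomb_mat N J c A * R) =
    (\<Sum>p\<in>J. \<Sum>q\<in>J. c p * c q * mtrace (A p * A q * R))"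
proof -
  let ?L = "lincomb_mat N J c A"
  have "mtrace (?L * ?L * R) = mtrace (?L * (?L * R))"
    using R by (simp add: assoc_mult_mat[of _ N N _ N _ N])
  also have "\<dots> = (\<Sum>p\<in>J. c p * mtrace (A p * (?L * R)))"
    using A R by (intro mtrace_lincomb_mult) (auto intro: square_mult_carrier)
  also have "\<dots> = (\<Sum>p\<in>J. c p * (\<Sum>q\<in>J. c q * mtrace (A p * A q * R)))"
  proof (intro sum.cong refl arg_cong2[of _ _ _ _ "(*)"])
    fix p assume p: "p \<in> J"
    have "A p * (?L * R) = A p * ?L * R"
      using A[OF p] R by (simp add: assoc_mult_mat[of _ N N _ N _ N])
    also have "\<dots> = lincomb_mat N J c (\<lambda>q. A p * A q * R)"
      using A[OF p] A R by (simp add: lincomb_mat_mult_left lincomb_mat_mult_right square_mult_carrier)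
    finally show "mtrace (A p * (?L * R)) = (\<Sum>q\<in>J. c q * mtrace (A p * A q * R))"
      using A[OF p] A R by (simp add: mtrace_lincomb_mat square_mult_carrier)
  qed
  finally show ?thesis by (simp add: sum_distrib_left mult.assoc)
qed

section \<open>Moments of the swap observable\<close>

text \<open>The matrix unit with its single 1 in row \<open>a\<close> and column
  \<open>b\<close>.\<close>

definition elem_mat :: "nat \<Rightarrow> nat \<Rightarrow> nat \<Rightarrow> complex mat" where
  "elem_mat d a b = mat d d (\<lambda>(x,y). if x = a \<and> y = b then 1 else 0)"

lemma elem_mat_carrier [simp]: "elem_mat d a b \<in> carrier_mat d d"
  by (simp add: elem_mat_def)

lemma elem_mat_mult_index:
  assumes "R \<in> carrier_mat d d" "a < d" "b < d" "i < d" "j < d"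
  shows "(elem_mat d a b * R) $$ (i,j) = (if i = a then R $$ (b,j) else 0)"
proof -
  have "(elem_mat d a b * R) $$ (i,j) = (\<Sum>k<d. if k = b then (if i = a then R $$ (b,j) else 0) else 0)"
    unfolding mult_mat_index[OF elem_mat_carrier assms(1,4,5)]
    using assms by (intro sum.cong) (auto simp: elem_mat_def)
  then show ?thesis using assms by simp
qed

lemma mtrace_elem_mat_mult:
  assumes "R \<in> carrier_mat d d" "a < d" "b < d"
  shows "mtrace (elem_mat d a b * R) = R $$ (b,a)"
proof -
  have "mtrace (elem_mat d a b * R) = (\<Sum>i<d. if i = a then R $$ (b,i) else 0)"
    using assms elem_mat_mult_index[OF assms] by (auto simp: mtrace_def elem_mat_def intro!: sum.cong simp del: index_mult_mat(1))
  then show ?thesis using assms by simp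
qed

lemma mtrace_elem_mat_mult2:
  assumes R: "R \<in> carrier_mat d d" and abce: "a < d" "b < d" "c < d" "e < d"
  shows "mtrace (elem_mat d a b * elem_mat d c e * R) = (if b = c then R $$ (e,a) else 0)"
proof -
  have "mtrace (elem_mat d a b * elem_mat d c e * R) = mtrace (elem_mat d a b * (elem_mat d c e * R))"
    using R by (simp add: assoc_mult_mat[of _ d d _ d _ d])
  also have "\<dots> = (elem_mat d c e * R) $$ (b,a)"
    using R abce by (intro mtrace_elem_mat_mult) (auto intro: square_mult_carrier)
  finally show ?thesis using elem_mat_mult_index[OF R abce(3,4,2,1)] by simp
qed

text \<open>What factor \<open>k\<close> sees of one term in the expansion of the swap of
  \<open>i\<close> and \<open>j\<close> into matrix units.\<close>

definition swap_factor :: "nat \<Rightarrow> nat \<Rightarrow> nat \<Rightarrow> nat \<Rightarrow> nat \<Rightarrow> nat \<Rightarrow> complex mat" where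
  "swap_factor d i j a b k =
    (if k = i then elem_mat d a b else if k = j then elem_mat d b a else 1\<^sub>m d)"

lemma swap_factor_carrier [simp]: "swap_factor d i j a b k \<in> carrier_mat d d"
  by (simp add: swap_factor_def)

definition off_pairs :: "nat \<Rightarrow> (nat \<times> nat) set" where
  "off_pairs n = {(i,j). i < n \<and> j < n \<and> i \<noteq> j}"

lemma finite_off_pairs [simp]: "finite (off_pairs n)"
  by (rule finite_subset[of _ "{..<n} \<times> {..<n}"]) (auto simp: off_pairs_def)

text \<open>The swap of factors \<open>i\<close> and \<open>j\<close> is the sum over \<open>a, b\<close> of the product operators acting as
  the matrix unit \<open>E\<^bsub>ab\<^esub>\<close> on factor \<open>i\<close> and \<open>E\<^bsub>ba\<^esub>\<close> on factor \<open>j\<close>.\<close>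

definition swap_obs :: "nat \<Rightarrow> nat \<Rightarrow> (nat \<Rightarrow> real) \<Rightarrow> complex mat" where
  "swap_obs d n w = lincomb_mat (d ^ n) (off_pairs n \<times> ({..<d} \<times> {..<d}))
     (\<lambda>((i,j),_). complex_of_real (w i * w j)) (\<lambda>((i,j),(a,b)). tens n (swap_factor d i j a b))"

lemma swap_obs_carrier [simp]: "swap_obs d n w \<in> carrier_mat (d ^ n) (d ^ n)"
  by (simp add: swap_obs_def)

lemma tens_swap_factor_carrier [simp]:
  "tens n (swap_factor d i j a b) \<in> carrier_mat (d ^ n) (d ^ n)"
  by (rule tens_carrier) simp

text \<open>Taking the adjoint of a term exchanges the labels \<open>a\<close> and \<open>b\<close>.
  The coefficients are real and do not involve these labels, so the sum is merely permuted.\<close>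

lemma swap_obs_hermitian: "mat_adjoint (swap_obs d n w) = swap_obs d n w"
proof (rule eq_matI)
  fix x y assume "x < dim_row (swap_obs d n w)" "y < dim_col (swap_obs d n w)"
  then have xy: "x < d ^ n" "y < d ^ n" using swap_obs_carrier[of d n w] by auto
  have adj: "cnj (tens n (swap_factor d i j a b) $$ (y,x)) = tens n (swap_factor d i j b a) $$ (x,y)" for i j a b
  proof -
    have e: "mat_adjoint (elem_mat d a b) = elem_mat d b a" for a b
      by (rule eq_matI) (auto simp: elem_mat_def)
    have "mat_adjoint (tens n (swap_factor d i j a b)) = tens n (swap_factor d i j b a)"
      unfolding tens_adjoint by (intro tens_cong) (auto simp: swap_factor_def e)
    from arg_cong[OF this, of "\<lambda>M. M $$ (x,y)"] show ?thesis
      using xy tens_swap_factor_carrier[of n d i j a b] by auto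
  qed
  have "mat_adjoint (swap_obs d n w) $$ (x,y) = cnj (swap_obs d n w $$ (y,x))"
    using xy by (simp add: carrier_matD[OF swap_obs_carrier])
  also have "\<dots> = (\<Sum>((i,j),(a,b))\<in>off_pairs n \<times> ({..<d} \<times> {..<d}).
      complex_of_real (w i * w j) * tens n (swap_factor d i j b a) $$ (x,y))"
    unfolding swap_obs_def lincomb_mat_def using xy by (auto simp: adj intro!: sum.cong)
  also have "\<dots> = (\<Sum>((i,j),(a,b))\<in>off_pairs n \<times> ({..<d} \<times> {..<d}).
      complex_of_real (w i * w j) * tens n (swap_factor d i j a b) $$ (x,y))"
    by (rule sum.reindex_bij_witness[of _ "\<lambda>(p,(a,b)). (p,(b,a))" "\<lambda>(p,(a,b)). (p,(b,a))"]) auto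
  also have "\<dots> = swap_obs d n w $$ (x,y)"
    unfolding swap_obs_def lincomb_mat_def using xy by (auto intro!: sum.cong)
  finally show "mat_adjoint (swap_obs d n w) $$ (x,y) = swap_obs d n w $$ (x,y)" .
qed (simp_all add: carrier_matD[OF swap_obs_carrier])

section \<open>Moments of swaps in a product state\<close>

lemma sum_if_const: "(\<Sum>x\<in>A. if P then f x else 0) = (if P then \<Sum>x\<in>A. f x else 0)"
  by simp

text \<open>Factors on which all swaps act as the identity contribute the trace of a state, which is
  1, so traces of products of swaps reduce to the indices involved.\<close>

lemma prod_supported:
  fixes n :: nat
  assumes "U \<subseteq> {..<n}" "\<And>m. m < n \<Longrightarrow> m \<notin> U \<Longrightarrow> f m = 1"
  shows "(\<Prod>m<n. f m) = (\<Prod>m\<in>U. f m)"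
  using assms by (intro prod.mono_neutral_right) auto

text \<open>Collects what the moment formulas rest on: square factors of unit trace. Positivity
  enters with \<open>density_states\<close>.\<close>

locale product_state =
  fixes d n :: nat and \<tau> :: "nat \<Rightarrow> complex mat"
  assumes carrier: "k < n \<Longrightarrow> \<tau> k \<in> carrier_mat d d"
    and trace_one: "k < n \<Longrightarrow> mtrace (\<tau> k) = 1"
begin

text \<open>The trace of the product of factors \<open>i\<close> and \<open>j\<close>, the mean of
  their swap.\<close>

definition overlap2 :: "nat \<Rightarrow> nat \<Rightarrow> complex" where
  "overlap2 i j = (\<Sum>a<d. \<Sum>b<d. \<tau> i $$ (b,a) * \<tau> j $$ (a,b))"

text \<open>The trace of the product of factors \<open>i\<close>, \<open>j\<close> and
  \<open>l\<close> in this order.\<close>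

definition overlap3 :: "nat \<Rightarrow> nat \<Rightarrow> nat \<Rightarrow> complex" where
  "overlap3 i j l = (\<Sum>a<d. \<Sum>b<d. \<Sum>e<d. \<tau> i $$ (e,a) * \<tau> j $$ (a,b) * \<tau> l $$ (b,e))"

text \<open>For \<open>i \<noteq> j\<close> and \<open>k \<noteq> l\<close>, the mean of the product
  of the swaps on (i, j) and (k, l), expanded in matrix units.\<close>

definition swap_moment :: "nat \<Rightarrow> nat \<Rightarrow> nat \<Rightarrow> nat \<Rightarrow> complex" where
  "swap_moment i j k l = (\<Sum>(a,b)\<in>{..<d}\<times>{..<d}. \<Sum>(c,e)\<in>{..<d}\<times>{..<d}.
     \<Prod>m<n. mtrace (swap_factor d i j a b m * swap_factor d k l c e m * \<tau> m))"

lemma tens_carrier': "tens n \<tau> \<in> carrier_mat (d ^ n) (d ^ n)"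
  by (rule tens_carrier) (rule carrier)

lemma prod_trace_swap_factor:
  assumes "i < n" "j < n" "i \<noteq> j" "a < d" "b < d"
  shows "(\<Prod>m<n. mtrace (swap_factor d i j a b m * \<tau> m)) = \<tau> i $$ (b,a) * \<tau> j $$ (a,b)"
proof -
  have "(\<Prod>m<n. mtrace (swap_factor d i j a b m * \<tau> m)) = (\<Prod>m\<in>{i,j}. mtrace (swap_factor d i j a b m * \<tau> m))"
    using assms carrier trace_one by (intro prod_supported) (auto simp: swap_factor_def left_mult_one_mat[of _ d d])
  then show ?thesis using assms carrier by (simp add: swap_factor_def mtrace_elem_mat_mult)
qed

lemma mtrace_swap_obs:
  "mtrace (swap_obs d n w * tens n \<tau>) = (\<Sum>(i,j)\<in>off_pairs n. complex_of_real (w i * w j) * overlap2 i j)"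
proof -
  have "mtrace (tens n (swap_factor d i j a b) * tens n \<tau>) = \<tau> i $$ (b,a) * \<tau> j $$ (a,b)"
    if "(i,j) \<in> off_pairs n" "a < d" "b < d" for i j a b
    using that carrier
    by (simp add: tens_mult[of n _ d] tens_mtrace[of n _ d] square_mult_carrier prod_trace_swap_factor off_pairs_def)
  then have "mtrace (swap_obs d n w * tens n \<tau>) = (\<Sum>((i,j),(a,b))\<in>off_pairs n \<times> ({..<d} \<times> {..<d}).
      complex_of_real (w i * w j) * (\<tau> i $$ (b,a) * \<tau> j $$ (a,b)))"
    unfolding swap_obs_def
    by (subst mtrace_lincomb_mult) (auto simp: tens_carrier' intro!: sum.cong)
  also have "\<dots> = (\<Sum>(i,j)\<in>off_pairs n. complex_of_real (w i * w j) * overlap2 i j)"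
    by (auto simp: overlap2_def sum.cartesian_product[symmetric] sum_distrib_left intro!: sum.cong)
  finally show ?thesis .
qed

lemma mtrace_swap_obs_square:
  "mtrace (swap_obs d n w * swap_obs d n w * tens n \<tau>) =
    (\<Sum>(i,j)\<in>off_pairs n. \<Sum>(k,l)\<in>off_pairs n. complex_of_real (w i * w j * (w k * w l)) * swap_moment i j k l)"
proof -
  let ?P = "off_pairs n" and ?D = "{..<d} \<times> {..<d}"
  let ?F = "\<lambda>i j a b k l c e. \<Prod>m<n. mtrace (swap_factor d i j a b m * swap_factor d k l c e m * \<tau> m)"
  have "mtrace (tens n (swap_factor d i j a b) * tens n (swap_factor d k l c e) * tens n \<tau>) = ?F i j a b k l c e"
    for i j a b k l c e
    using carrier by (simp add: tens_mult[of n _ d] tens_mtrace[of n _ d] square_mult_carrier)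
  then have "mtrace (swap_obs d n w * swap_obs d n w * tens n \<tau>) =
      (\<Sum>((i,j),(a,b))\<in>?P \<times> ?D. \<Sum>((k,l),(c,e))\<in>?P \<times> ?D.
         complex_of_real (w i * w j) * complex_of_real (w k * w l) * ?F i j a b k l c e)"
    unfolding swap_obs_def
    by (subst mtrace_lincomb_mult2) (auto simp: tens_carrier' intro!: sum.cong)
  also have "\<dots> = (\<Sum>(i,j)\<in>?P. \<Sum>(a,b)\<in>?D. \<Sum>(k,l)\<in>?P. \<Sum>(c,e)\<in>?D.
         complex_of_real (w i * w j) * complex_of_real (w k * w l) * ?F i j a b k l c e)"
    by (simp only: sum.cartesian_product' case_prod_unfold fst_conv snd_conv)
  \<comment> \<open>Exchanging the sums over matrix labels and over the second pair collects each
    pair of swaps into one \<open>swap_moment\<close>.\<close>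
  also have "\<dots> = (\<Sum>(i,j)\<in>?P. \<Sum>(k,l)\<in>?P. \<Sum>(a,b)\<in>?D. \<Sum>(c,e)\<in>?D.
         complex_of_real (w i * w j) * complex_of_real (w k * w l) * ?F i j a b k l c e)"
    by (rule sum.cong[OF refl], unfold case_prod_unfold, rule sum.swap)
  also have "\<dots> = (\<Sum>(i,j)\<in>?P. \<Sum>(k,l)\<in>?P. complex_of_real (w i * w j * (w k * w l)) * swap_moment i j k l)"
    by (simp add: swap_moment_def sum_distrib_left case_prod_unfold)
  finally show ?thesis .
qed

text \<open>A swap is symmetric in its two factors; in the expansion this exchanges the two matrix
  labels.\<close>

lemma swap_moment_commute_right: "k \<noteq> l \<Longrightarrow> swap_moment i j k l = swap_moment i j l k"
  unfolding swap_moment_def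
proof (intro sum.cong refl, clarify)
  fix a b assume "k \<noteq> l"
  then have "swap_factor d l k c e = swap_factor d k l e c" for c e by (auto simp: swap_factor_def)
  then show "(\<Sum>(c,e)\<in>{..<d} \<times> {..<d}. \<Prod>m<n. mtrace (swap_factor d i j a b m * swap_factor d k l c e m * \<tau> m)) =
    (\<Sum>(c,e)\<in>{..<d} \<times> {..<d}. \<Prod>m<n. mtrace (swap_factor d i j a b m * swap_factor d l k c e m * \<tau> m))"
    by (intro sum.reindex_bij_witness[of _ prod.swap prod.swap]) auto
qed

lemma swap_moment_commute_left:
  assumes "i \<noteq> j" shows "swap_moment i j k l = swap_moment j i k l"
proof -
  have "swap_factor d j i c e = swap_factor d i j e c" for c e using assms by (auto simp: swap_factor_def)
  then show ?thesis unfolding swap_moment_def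
    by (intro sum.reindex_bij_witness[of _ prod.swap prod.swap]) auto
qed

text \<open>The swaps act on different tensor factors, and in a product state such operators are
  independent. Hence disjoint pairs have covariance zero.\<close>

lemma swap_moment_disjoint:
  assumes "i < n" "j < n" "k < n" "l < n" "i \<noteq> j" "k \<noteq> l" "{i,j} \<inter> {k,l} = {}"
  shows "swap_moment i j k l = overlap2 i j * overlap2 k l"
proof -
  have neq: "i \<noteq> k" "i \<noteq> l" "j \<noteq> k" "j \<noteq> l" using assms(7) by auto
  note ne = neq neq[symmetric] assms(5,6) assms(5,6)[symmetric]
  have *: "(\<Prod>m<n. mtrace (swap_factor d i j a b m * swap_factor d k l c e m * \<tau> m)) =
      \<tau> i $$ (b,a) * \<tau> j $$ (a,b) * (\<tau> k $$ (e,c) * \<tau> l $$ (c,e))"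
    if "a < d" "b < d" "c < d" "e < d" for a b c e
  proof -
    have "(\<Prod>m<n. mtrace (swap_factor d i j a b m * swap_factor d k l c e m * \<tau> m)) =
        (\<Prod>m\<in>{i,j,k,l}. mtrace (swap_factor d i j a b m * swap_factor d k l c e m * \<tau> m))"
      using assms carrier trace_one by (intro prod_supported) (auto simp: swap_factor_def left_mult_one_mat[of _ d d])
    also have "\<dots> = \<tau> i $$ (b,a) * \<tau> j $$ (a,b) * (\<tau> k $$ (e,c) * \<tau> l $$ (c,e))"
      by (simp add: swap_factor_def mtrace_elem_mat_mult right_mult_one_mat[of _ d d] left_mult_one_mat[of _ d d]
          mult.assoc carrier assms(1-4) ne that)
    finally show ?thesis .
  qed
  have "swap_moment i j k l = (\<Sum>(a,b)\<in>{..<d} \<times> {..<d}. \<Sum>(c,e)\<in>{..<d} \<times> {..<d}.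
      \<tau> i $$ (b,a) * \<tau> j $$ (a,b) * (\<tau> k $$ (e,c) * \<tau> l $$ (c,e)))"
    unfolding swap_moment_def by (intro sum.cong refl) (auto simp: * intro!: sum.cong)
  also have "\<dots> = (\<Sum>(a,b)\<in>{..<d} \<times> {..<d}. \<tau> i $$ (b,a) * \<tau> j $$ (a,b)) * (\<Sum>(c,e)\<in>{..<d} \<times> {..<d}. \<tau> k $$ (e,c) * \<tau> l $$ (c,e))"
    by (simp add: sum_product case_prod_unfold)
  finally show ?thesis by (simp add: overlap2_def sum.cartesian_product)
qed

text \<open>A swap squares to the identity, whose mean is 1.\<close>

lemma swap_moment_same:
  assumes "i < n" "j < n" "i \<noteq> j"
  shows "swap_moment i j i j = 1"
proof -
  \<comment> \<open>The two matrix units meeting on factor \<open>i\<close> force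
    \<open>c = b\<close>, those on factor \<open>j\<close> force \<open>e = a\<close>.\<close>
  have *: "(\<Prod>m<n. mtrace (swap_factor d i j a b m * swap_factor d i j c e m * \<tau> m)) =
      (if c = b then if e = a then \<tau> i $$ (a,a) * \<tau> j $$ (b,b) else 0 else 0)"
    if "a < d" "b < d" "c < d" "e < d" for a b c e
  proof -
    have "(\<Prod>m<n. mtrace (swap_factor d i j a b m * swap_factor d i j c e m * \<tau> m)) =
        (\<Prod>m\<in>{i,j}. mtrace (swap_factor d i j a b m * swap_factor d i j c e m * \<tau> m))"
      using assms carrier trace_one by (intro prod_supported) (auto simp: swap_factor_def left_mult_one_mat[of _ d d])
    then show ?thesis
      using assms carrier that by (auto simp: swap_factor_def mtrace_elem_mat_mult2)
  qed
  have tr: "(\<Sum>a<d. \<tau> k $$ (a,a)) = 1" if "k < n" for k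
    using carrier[OF that] trace_one[OF that] by (simp add: mtrace_def)
  have "swap_moment i j i j = (\<Sum>a<d. \<Sum>b<d. \<Sum>c<d. \<Sum>e<d.
      if c = b then if e = a then \<tau> i $$ (a,a) * \<tau> j $$ (b,b) else 0 else 0)"
    unfolding swap_moment_def sum.cartesian_product[symmetric] by (intro sum.cong refl) (auto simp: *)
  also have "\<dots> = (\<Sum>a<d. \<Sum>b<d. \<Sum>c<d. if c = b then \<tau> i $$ (a,a) * \<tau> j $$ (b,b) else 0)"
    by (intro sum.cong refl) auto
  also have "\<dots> = (\<Sum>a<d. \<Sum>b<d. \<tau> i $$ (a,a) * \<tau> j $$ (b,b))"
    by (intro sum.cong refl) auto
  also have "\<dots> = (\<Sum>a<d. \<tau> i $$ (a,a)) * (\<Sum>b<d. \<tau> j $$ (b,b))" by (simp add: sum_product)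
  finally show ?thesis by (simp add: tr assms)
qed

text \<open>Two transpositions with one common index compose to a 3-cycle, and the mean of a cyclic
  permutation is the trace of the product along the cycle.\<close>

lemma swap_moment_shared:
  assumes "i < n" "j < n" "l < n" "i \<noteq> j" "l \<noteq> i" "l \<noteq> j"
  shows "swap_moment i j i l = overlap3 i j l"
proof -
  have *: "(\<Prod>m<n. mtrace (swap_factor d i j a b m * swap_factor d i l c e m * \<tau> m)) =
      (if c = b then \<tau> i $$ (e,a) * \<tau> j $$ (a,b) * \<tau> l $$ (b,e) else 0)"
    if "a < d" "b < d" "c < d" "e < d" for a b c e
  proof -
    have "(\<Prod>m<n. mtrace (swap_factor d i j a b m * swap_factor d i l c e m * \<tau> m)) =
        (\<Prod>m\<in>{i,j,l}. mtrace (swap_factor d i j a b m * swap_factor d i l c e m * \<tau> m))"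
      using assms carrier trace_one by (intro prod_supported) (auto simp: swap_factor_def left_mult_one_mat[of _ d d])
    then show ?thesis
      using assms carrier that
      by (auto simp: swap_factor_def mtrace_elem_mat_mult2 mtrace_elem_mat_mult right_mult_one_mat[of _ d d] left_mult_one_mat[of _ d d])
  qed
  have "swap_moment i j i l = (\<Sum>a<d. \<Sum>b<d. \<Sum>c<d. \<Sum>e<d.
      if c = b then \<tau> i $$ (e,a) * \<tau> j $$ (a,b) * \<tau> l $$ (b,e) else 0)"
    unfolding swap_moment_def sum.cartesian_product[symmetric] by (intro sum.cong refl) (auto simp: *)
  also have "\<dots> = (\<Sum>a<d. \<Sum>b<d. \<Sum>c<d. if c = b then (\<Sum>e<d. \<tau> i $$ (e,a) * \<tau> j $$ (a,b) * \<tau> l $$ (b,e)) else 0)"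
    by (simp only: sum_if_const)
  also have "\<dots> = overlap3 i j l"
    by (simp add: overlap3_def cong: sum.cong_simp)
  finally show ?thesis .
qed

end

section \<open>Mean and variance bounds\<close>

lemma Re_scale: "Re (complex_of_real x * z) = x * Re z" "Re (complex_of_real x * complex_of_real y * z) = x * y * Re z"
  by simp_all

lemma sum_off_pairs:
  fixes n :: nat and f :: "nat \<Rightarrow> nat \<Rightarrow> 'a::comm_monoid_add"
  shows "(\<Sum>(i,j)\<in>off_pairs n. f i j) = (\<Sum>i<n. \<Sum>j\<in>{..<n}-{i}. f i j)"
proof -
  have "off_pairs n = (SIGMA i:{..<n}. {..<n} - {i})" by (auto simp: off_pairs_def)
  then show ?thesis by (simp add: sum.Sigma)
qed

text \<open>The ordered pairs meeting {i, j} are (i, j) and (j, i), and for each third index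
  \<open>l\<close> both orders of (i, l) and (j, l). Symmetry merges the two orders into the factors
  2.\<close>

lemma sum_pairs_meeting:
  fixes F :: "nat \<Rightarrow> nat \<Rightarrow> real"
  assumes ij: "i < n" "j < n" "i \<noteq> j"
    and disj: "\<And>k l. k < n \<Longrightarrow> l < n \<Longrightarrow> k \<noteq> l \<Longrightarrow> {i,j} \<inter> {k,l} = {} \<Longrightarrow> F k l = 0"
    and sym: "\<And>k l. k < n \<Longrightarrow> l < n \<Longrightarrow> k \<noteq> l \<Longrightarrow> F k l = F l k"
  shows "(\<Sum>(k,l)\<in>off_pairs n. F k l) = 2 * F i j + 2 * (\<Sum>l\<in>{..<n}-{i,j}. F i l + F j l)"
proof -
  let ?R = "{..<n} - {i,j}"
  have I: "{..<n} = insert i (insert j ?R)" using ij by auto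
  have Ii: "{..<n} - {i} = insert j ?R" and Ij: "{..<n} - {j} = insert i ?R" using ij by auto
  \<comment> \<open>From a third index \<open>k\<close>, only the partners \<open>i\<close> and
    \<open>j\<close> give a pair that meets {i, j}.\<close>
  have row: "(\<Sum>l\<in>{..<n}-{k}. F k l) = F i k + F j k" if k: "k \<in> ?R" for k
  proof -
    have eq: "{..<n} - {k} = insert i (insert j ({..<n} - {i,j,k}))" using ij k by auto
    have "(\<Sum>l\<in>{..<n} - {i,j,k}. F k l) = 0" using k by (intro sum.neutral) (auto intro: disj)
    then have "(\<Sum>l\<in>{..<n}-{k}. F k l) = F k i + F k j" unfolding eq using ij by simp
    then show ?thesis using sym[of k i] sym[of k j] ij k by simp
  qed
  have "(\<Sum>(k,l)\<in>off_pairs n. F k l) = (\<Sum>k\<in>insert i (insert j ?R). \<Sum>l\<in>{..<n}-{k}. F k l)"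
    unfolding sum_off_pairs using I by simp
  also have "\<dots> = (\<Sum>l\<in>{..<n}-{i}. F i l) + (\<Sum>l\<in>{..<n}-{j}. F j l) + (\<Sum>k\<in>?R. \<Sum>l\<in>{..<n}-{k}. F k l)"
    using ij by simp
  also have "(\<Sum>k\<in>?R. \<Sum>l\<in>{..<n}-{k}. F k l) = (\<Sum>k\<in>?R. F i k + F j k)"
    by (intro sum.cong refl row)
  also have "(\<Sum>l\<in>{..<n}-{i}. F i l) = F i j + (\<Sum>l\<in>?R. F i l)" unfolding Ii by simp
  also have "(\<Sum>l\<in>{..<n}-{j}. F j l) = F i j + (\<Sum>l\<in>?R. F j l)" unfolding Ij using sym ij by simp
  finally show ?thesis by (simp add: sum.distrib)
qed

text \<open>Only pairs sharing an index are correlated: a coincident pair contributes at most 1, and for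
  a single common index \<open>i\<close> the sum over the other two indices is completed to a full double sum
  at the cost of at most \<open>6 n\<close>.\<close>

lemma pair_covariance_bound:
  fixes w :: "nat \<Rightarrow> real" and g :: "nat \<Rightarrow> nat \<Rightarrow> nat \<Rightarrow> nat \<Rightarrow> real"
    and t :: "nat \<Rightarrow> nat \<Rightarrow> nat \<Rightarrow> real" and c :: "nat \<Rightarrow> nat \<Rightarrow> real"
  assumes w: "\<And>i. w i * w i = 1"
    and disj: "\<And>i j k l. i < n \<Longrightarrow> j < n \<Longrightarrow> k < n \<Longrightarrow> l < n \<Longrightarrow> i \<noteq> j \<Longrightarrow> k \<noteq> l \<Longrightarrow>
      {i,j} \<inter> {k,l} = {} \<Longrightarrow> g i j k l = 0"
    and symr: "\<And>i j k l. i < n \<Longrightarrow> j < n \<Longrightarrow> k < n \<Longrightarrow> l < n \<Longrightarrow> i \<noteq> j \<Longrightarrow> k \<noteq> l \<Longrightarrow> g i j k l = g i j l k"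
    and syml: "\<And>i j k l. i < n \<Longrightarrow> j < n \<Longrightarrow> k < n \<Longrightarrow> l < n \<Longrightarrow> i \<noteq> j \<Longrightarrow> k \<noteq> l \<Longrightarrow> g i j k l = g j i k l"
    and same: "\<And>i j. i < n \<Longrightarrow> j < n \<Longrightarrow> i \<noteq> j \<Longrightarrow> g i j i j \<le> 1"
    and shared: "\<And>i j l. i < n \<Longrightarrow> j < n \<Longrightarrow> l < n \<Longrightarrow> i \<noteq> j \<Longrightarrow> l \<noteq> i \<Longrightarrow> l \<noteq> j \<Longrightarrow>
      g i j i l = t i j l - c i j * c i l"
    and t1: "\<And>i j l. i < n \<Longrightarrow> j < n \<Longrightarrow> l < n \<Longrightarrow> \<bar>t i j l\<bar> \<le> 1"
    and c1: "\<And>i j. i < n \<Longrightarrow> j < n \<Longrightarrow> \<bar>c i j\<bar> \<le> 1"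
    and full: "\<And>i. i < n \<Longrightarrow> (\<Sum>j<n. \<Sum>l<n. w j * w l * t i j l) \<le> B"
  shows "(\<Sum>(i,j)\<in>off_pairs n. \<Sum>(k,l)\<in>off_pairs n. w i * w j * (w k * w l) * g i j k l)
    \<le> 26 * (real n)\<^sup>2 + 4 * real n * B"
proof -
  \<comment> \<open>The covariance of the swaps on (i, j) and (i, l). The common index carries the
    weight \<open>w i * w i = 1\<close>, so only the weights of \<open>j\<close> and
    \<open>l\<close> survive in \<open>S\<close>.\<close>
  define h where "h i j l = t i j l - c i j * c i l" for i j l
  define S where "S i = (\<Sum>j\<in>{..<n}-{i}. \<Sum>l\<in>{..<n}-{i,j}. w j * w l * h i j l)" for i
  have inner: "(\<Sum>(k,l)\<in>off_pairs n. w i * w j * (w k * w l) * g i j k l) =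
      2 * g i j i j + 2 * (\<Sum>l\<in>{..<n}-{i,j}. w j * w l * h i j l + w i * w l * h j i l)"
    if ij: "i < n" "j < n" "i \<noteq> j" for i j
  proof -
    have "(\<Sum>(k,l)\<in>off_pairs n. w i * w j * (w k * w l) * g i j k l) =
        2 * (w i * w j * (w i * w j) * g i j i j) + 2 * (\<Sum>l\<in>{..<n}-{i,j}.
          w i * w j * (w i * w l) * g i j i l + w i * w j * (w j * w l) * g i j j l)"
      using ij by (intro sum_pairs_meeting) (auto simp: disj symr)
    also have "w i * w j * (w i * w j) * g i j i j = (w i * w i) * (w j * w j) * g i j i j" by simp
    also have "\<dots> = g i j i j" by (simp add: w)
    also have "(\<Sum>l\<in>{..<n}-{i,j}. w i * w j * (w i * w l) * g i j i l + w i * w j * (w j * w l) * g i j j l) =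
        (\<Sum>l\<in>{..<n}-{i,j}. w j * w l * h i j l + w i * w l * h j i l)"
    proof (intro sum.cong refl)
      fix l assume l: "l \<in> {..<n}-{i,j}"
      have "w i * w j * (w i * w l) * g i j i l = (w i * w i) * (w j * w l * g i j i l)" by simp
      also have "\<dots> = w j * w l * h i j l" using ij l shared[of i j l] by (simp add: w h_def)
      finally have 1: "w i * w j * (w i * w l) * g i j i l = w j * w l * h i j l" .
      have "w i * w j * (w j * w l) * g i j j l = (w j * w j) * (w i * w l * g i j j l)" by simp
      also have "\<dots> = w i * w l * h j i l" using ij l shared[of j i l] syml[of i j j l] by (simp add: w h_def)
      finally have 2: "w i * w j * (w j * w l) * g i j j l = w i * w l * h j i l" .
      show "w i * w j * (w i * w l) * g i j i l + w i * w j * (w j * w l) * g i j j l =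
          w j * w l * h i j l + w i * w l * h j i l" by (simp only: 1 2)
    qed
    finally show ?thesis .
  qed
  \<comment> \<open>Renaming \<open>i\<close> and \<open>j\<close> shows that pairs sharing the
    second index contribute as much as those sharing the first.\<close>
  have swap: "(\<Sum>(i,j)\<in>off_pairs n. \<Sum>l\<in>{..<n}-{i,j}. w i * w l * h j i l) = (\<Sum>i<n. S i)"
  proof -
    have "(\<Sum>(i,j)\<in>off_pairs n. \<Sum>l\<in>{..<n}-{i,j}. w i * w l * h j i l) =
        (\<Sum>(i,j)\<in>off_pairs n. \<Sum>l\<in>{..<n}-{i,j}. w j * w l * h i j l)"
      by (rule sum.reindex_bij_witness[of _ prod.swap prod.swap]) (auto simp: off_pairs_def insert_commute)
    then show ?thesis by (simp add: S_def sum_off_pairs)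
  qed
  have "(\<Sum>(i,j)\<in>off_pairs n. \<Sum>(k,l)\<in>off_pairs n. w i * w j * (w k * w l) * g i j k l) =
      (\<Sum>(i,j)\<in>off_pairs n. 2 * g i j i j + 2 * (\<Sum>l\<in>{..<n}-{i,j}. w j * w l * h i j l + w i * w l * h j i l))"
  proof (rule sum.cong[OF refl])
    fix p assume "p \<in> off_pairs n"
    then obtain i j where p: "p = (i,j)" and ij: "i < n" "j < n" "i \<noteq> j" by (auto simp: off_pairs_def)
    show "(case p of (i,j) \<Rightarrow> \<Sum>(k,l)\<in>off_pairs n. w i * w j * (w k * w l) * g i j k l) = (case p of (i,j) \<Rightarrow>
        2 * g i j i j + 2 * (\<Sum>l\<in>{..<n}-{i,j}. w j * w l * h i j l + w i * w l * h j i l))"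
      unfolding p prod.case by (rule inner[OF ij])
  qed
  also have "\<dots> = 2 * (\<Sum>(i,j)\<in>off_pairs n. g i j i j) + 2 * ((\<Sum>(i,j)\<in>off_pairs n. \<Sum>l\<in>{..<n}-{i,j}. w j * w l * h i j l)
      + (\<Sum>(i,j)\<in>off_pairs n. \<Sum>l\<in>{..<n}-{i,j}. w i * w l * h j i l))"
    by (simp add: case_prod_unfold sum.distrib sum_distrib_left)
  also have "\<dots> = 2 * (\<Sum>(i,j)\<in>off_pairs n. g i j i j) + 4 * (\<Sum>i<n. S i)"
    unfolding swap by (simp add: S_def sum_off_pairs)
  also have "(\<Sum>(i,j)\<in>off_pairs n. g i j i j) \<le> (real n)\<^sup>2"
  proof -
    have "(\<Sum>(i,j)\<in>off_pairs n. g i j i j) \<le> (\<Sum>p\<in>off_pairs n. 1)"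
      by (intro sum_mono) (auto simp: off_pairs_def same)
    also have "\<dots> = real (card (off_pairs n))" by simp
    also have "card (off_pairs n) \<le> card ({..<n} \<times> {..<n})"
      by (intro card_mono) (auto simp: off_pairs_def)
    finally show ?thesis by (simp add: power2_eq_square)
  qed
  also have "(\<Sum>i<n. S i) \<le> (\<Sum>i<n. B + 6 * real n)"
  proof (intro sum_mono)
    fix i assume "i \<in> {..<n}" then have i: "i < n" by simp
    have wabs: "\<bar>w j\<bar> = 1" for j using w[of j] by (metis abs_1 abs_mult_self_eq abs_ge_zero mult_cancel_left1 power2_eq_1_iff power2_eq_square abs_minus_cancel)
    have hb: "\<bar>w j * w l * h i j l\<bar> \<le> 2" if "j < n" "l < n" for j l
    proof -
      have "\<bar>c i j * c i l\<bar> \<le> 1 * 1" unfolding abs_mult using c1 i that by (intro mult_mono) auto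
      then have "\<bar>h i j l\<bar> \<le> 2" using t1[OF i that] unfolding h_def by linarith
      then show ?thesis by (simp add: abs_mult wabs)
    qed
    let ?f = "\<lambda>j l. w j * w l * h i j l"
    \<comment> \<open>Completing an inner sum adds the two terms \<open>l = i\<close> and
      \<open>l = j\<close>, each of absolute value at most 2; over all \<open>j\<close> this costs
      at most \<open>4 * n\<close>.\<close>
    have split: "(\<Sum>l<n. ?f j l) \<ge> (\<Sum>l\<in>{..<n}-{i,j}. ?f j l) - 4" if j: "j \<in> {..<n}-{i}" for j
    proof -
      have "{..<n} = insert i (insert j ({..<n}-{i,j}))" using i j by auto
      then have "(\<Sum>l<n. ?f j l) = (\<Sum>l\<in>insert i (insert j ({..<n}-{i,j})). ?f j l)" by simp
      also have "\<dots> = ?f j i + ?f j j + (\<Sum>l\<in>{..<n}-{i,j}. ?f j l)" using j by simp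
      finally show ?thesis using hb[of j i] hb[of j j] i j by auto
    qed
    \<comment> \<open>The added row \<open>j = i\<close> has \<open>n\<close> terms, each at least
      -2, which accounts for the other \<open>2 * n\<close>.\<close>
    have row: "(\<Sum>l<n. ?f i l) \<ge> - 2 * real n"
    proof -
      have "(\<Sum>l<n. ?f i l) \<ge> (\<Sum>l<n. -2)" using hb[OF i] by (intro sum_mono) (force simp: abs_le_iff)
      then show ?thesis by simp
    qed
    have "(\<Sum>j<n. \<Sum>l<n. ?f j l) = (\<Sum>l<n. ?f i l) + (\<Sum>j\<in>{..<n}-{i}. \<Sum>l<n. ?f j l)"
      using i by (subst sum.remove[of _ i]) auto
    also have "\<dots> \<ge> - 2 * real n + (\<Sum>j\<in>{..<n}-{i}. (\<Sum>l\<in>{..<n}-{i,j}. ?f j l) - 4)"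
      using row split by (intro add_mono sum_mono) auto
    finally have "S i \<le> (\<Sum>j<n. \<Sum>l<n. ?f j l) + 2 * real n + 4 * real (card ({..<n}-{i}))"
      by (simp add: S_def sum_subtractf)
    also have "4 * real (card ({..<n}-{i})) \<le> 4 * real n" using i by simp
    also have "(\<Sum>j<n. \<Sum>l<n. ?f j l) = (\<Sum>j<n. \<Sum>l<n. w j * w l * t i j l) - (\<Sum>j<n. w j * c i j)\<^sup>2"
      by (simp add: h_def right_diff_distrib sum_subtractf power2_eq_square sum_product mult_ac)
    also have "\<dots> \<le> B" using full[OF i] zero_le_power2[of "\<Sum>j<n. w j * c i j"] by linarith
    finally show "S i \<le> B + 6 * real n" by simp
  qed
  also have "2 * (real n)\<^sup>2 + 4 * (\<Sum>i<n. B + 6 * real n) = 26 * (real n)\<^sup>2 + 4 * real n * B"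
    by (simp add: power2_eq_square algebra_simps)
  finally show ?thesis by simp
qed

section \<open>Cauchy-Schwarz and Frobenius norm estimates\<close>

lemma cauchy_schwarz_complex_sum:
  fixes f g :: "'i \<Rightarrow> complex"
  shows "(cmod (\<Sum>i\<in>A. f i * g i))\<^sup>2 \<le> (\<Sum>i\<in>A. (cmod (f i))\<^sup>2) * (\<Sum>i\<in>A. (cmod (g i))\<^sup>2)"
proof -
  have "cmod (\<Sum>i\<in>A. f i * g i) \<le> (\<Sum>i\<in>A. \<bar>cmod (f i)\<bar> * \<bar>cmod (g i)\<bar>)"
    by (rule order_trans[OF norm_sum]) (simp add: norm_mult)
  also have "\<dots> \<le> L2_set (\<lambda>i. cmod (f i)) A * L2_set (\<lambda>i. cmod (g i)) A"
    by (rule L2_set_mult_ineq)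
  finally have "(cmod (\<Sum>i\<in>A. f i * g i))\<^sup>2 \<le> (L2_set (\<lambda>i. cmod (f i)) A * L2_set (\<lambda>i. cmod (g i)) A)\<^sup>2"
    by (intro power_mono) auto
  then show ?thesis by (simp add: L2_set_def power_mult_distrib sum_nonneg)
qed

text \<open>The squared Frobenius norm, taken of an entry function so that transposes and weighted
  sums can be written as plain functions of two indices.\<close>

definition frob_sq :: "nat \<Rightarrow> (nat \<Rightarrow> nat \<Rightarrow> complex) \<Rightarrow> real" where
  "frob_sq d A = (\<Sum>a<d. \<Sum>b<d. (cmod (A a b))\<^sup>2)"

lemma frob_sq_nonneg: "0 \<le> frob_sq d A"
  by (auto simp: frob_sq_def intro!: sum_nonneg)

lemma frob_sq_swap: "frob_sq d (\<lambda>a b. A b a) = frob_sq d A"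
  unfolding frob_sq_def by (rule sum.swap)

lemma cauchy_schwarz_frob:
  "(cmod (\<Sum>a<d. \<Sum>b<d. A a b * B a b))\<^sup>2 \<le> frob_sq d A * frob_sq d B"
  using cauchy_schwarz_complex_sum[of "\<lambda>(a,b). A a b" "\<lambda>(a,b). B a b" "{..<d} \<times> {..<d}"]
  by (simp add: frob_sq_def sum.cartesian_product case_prod_unfold)

text \<open>Each entry of the product is a row times a column; Cauchy-Schwarz bounds it, and summing
  over rows and columns separates the factors.\<close>

lemma frob_sq_mult:
  "frob_sq d (\<lambda>a e. \<Sum>b<d. A a b * B b e) \<le> frob_sq d A * frob_sq d B"
proof -
  have "frob_sq d (\<lambda>a e. \<Sum>b<d. A a b * B b e) \<le>
      (\<Sum>a<d. \<Sum>e<d. (\<Sum>b<d. (cmod (A a b))\<^sup>2) * (\<Sum>b<d. (cmod (B b e))\<^sup>2))"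
    unfolding frob_sq_def by (intro sum_mono cauchy_schwarz_complex_sum)
  also have "\<dots> = (\<Sum>a<d. \<Sum>b<d. (cmod (A a b))\<^sup>2) * (\<Sum>e<d. \<Sum>b<d. (cmod (B b e))\<^sup>2)"
    by (simp add: sum_product)
  also have "(\<Sum>e<d. \<Sum>b<d. (cmod (B b e))\<^sup>2) = frob_sq d B" unfolding frob_sq_def by (rule sum.swap)
  finally show ?thesis by (simp add: frob_sq_def)
qed

text \<open>Group the triple trace as \<open>A\<close> against the product of \<open>B\<close> and
  \<open>C\<close>, apply Cauchy-Schwarz, then submultiplicativity.\<close>

lemma cauchy_schwarz_frob3:
  "(cmod (\<Sum>a<d. \<Sum>b<d. \<Sum>e<d. A e a * B a b * C b e))\<^sup>2 \<le> frob_sq d A * (frob_sq d B * frob_sq d C)"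
proof -
  have "(\<Sum>a<d. \<Sum>b<d. \<Sum>e<d. A e a * B a b * C b e) = (\<Sum>a<d. \<Sum>e<d. A e a * (\<Sum>b<d. B a b * C b e))"
    unfolding sum_distrib_left mult.assoc by (rule sum.cong[OF refl], rule sum.swap)
  then have "(cmod (\<Sum>a<d. \<Sum>b<d. \<Sum>e<d. A e a * B a b * C b e))\<^sup>2 \<le>
      frob_sq d (\<lambda>a e. A e a) * frob_sq d (\<lambda>a e. \<Sum>b<d. B a b * C b e)"
    using cauchy_schwarz_frob by simp
  also have "\<dots> \<le> frob_sq d A * (frob_sq d B * frob_sq d C)"
    unfolding frob_sq_swap[of d A] by (intro mult_left_mono frob_sq_mult frob_sq_nonneg)
  finally show ?thesis .
qed

text \<open>Purity is at most 1. The entries are inner products of the columns of a Gram root, so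
  Cauchy-Schwarz bounds them by products of the diagonal entries \<open>s a\<close>, which sum to
  the trace.\<close>

lemma density_frob_sq_le_1:
  assumes "density d \<rho>"
  shows "frob_sq d (\<lambda>a b. \<rho> $$ (a,b)) \<le> 1"
proof -
  obtain B where B: "B \<in> carrier_mat d d" "\<rho> = mat_adjoint B * B"
    using assms psd_obtain_gram unfolding density_def by blast
  define b where "b k a = B $$ (k,a)" for k a
  define s where "s a = (\<Sum>k<d. (cmod (b k a))\<^sup>2)" for a
  have entry: "\<rho> $$ (a,a') = (\<Sum>k<d. cnj (b k a) * b k a')" if "a < d" "a' < d" for a a'
    unfolding B(2) mult_mat_index[OF mat_adjoint_carrier[OF B(1)] B(1) that]
    using that B(1) by (intro sum.cong) (auto simp: b_def)
  have bound: "(cmod (\<rho> $$ (a,a')))\<^sup>2 \<le> s a * s a'" if "a < d" "a' < d" for a a'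
    using cauchy_schwarz_complex_sum[of "\<lambda>k. cnj (b k a)" "\<lambda>k. b k a'" "{..<d}"]
    by (simp add: entry[OF that] s_def)
  have "\<rho> $$ (a,a) = complex_of_real (s a)" if "a < d" for a
    using complex_norm_square by (simp add: entry that s_def mult.commute del: of_real_power)
  then have "(\<Sum>a<d. complex_of_real (s a)) = 1"
    using assms B by (simp add: density_def mtrace_def)
  then have 1: "(\<Sum>a<d. s a) = 1" by (simp flip: of_real_sum)
  have "frob_sq d (\<lambda>a b. \<rho> $$ (a,b)) \<le> (\<Sum>a<d. \<Sum>b<d. s a * s b)"
    unfolding frob_sq_def by (intro sum_mono bound) auto
  also have "\<dots> = 1" by (simp add: 1 flip: sum_product)
  finally show ?thesis .
qed

section \<open>Mean and variance for density matrices\<close>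

locale density_states =
  fixes d n :: nat and \<tau> :: "nat \<Rightarrow> complex mat"
  assumes density: "k < n \<Longrightarrow> density d (\<tau> k)"

sublocale density_states \<subseteq> product_state
  by unfold_locales (use density in \<open>auto simp: density_def psd_def\<close>)

context density_states
begin

lemma hermitian_entry:
  assumes "k < n" "a < d" "b < d" shows "\<tau> k $$ (a,b) = cnj (\<tau> k $$ (b,a))"
proof -
  have "mat_adjoint (\<tau> k) = \<tau> k" using density assms by (auto simp: density_def psd_def)
  from arg_cong[OF this, of "\<lambda>M. M $$ (a,b)"] show ?thesis using assms carrier[of k] by auto
qed

lemma frob_le_1: "k < n \<Longrightarrow> frob_sq d (\<lambda>a b. \<tau> k $$ (a,b)) \<le> 1"
  by (intro density_frob_sq_le_1 density)

lemma overlap2_real: 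
  assumes "i < n" "j < n" shows "Im (overlap2 i j) = 0"
proof -
  have "cnj (overlap2 i j) = (\<Sum>a<d. \<Sum>b<d. \<tau> i $$ (a,b) * \<tau> j $$ (b,a))"
    using assms by (auto simp: overlap2_def hermitian_entry[symmetric] intro!: sum.cong)
  also have "\<dots> = overlap2 i j" unfolding overlap2_def by (rule sum.swap)
  finally show ?thesis by (simp add: complex_eq_iff)
qed

lemma cmod_overlap2_le_1:
  assumes "i < n" "j < n" shows "cmod (overlap2 i j) \<le> 1"
proof -
  have "(cmod (overlap2 i j))\<^sup>2 \<le> frob_sq d (\<lambda>a b. \<tau> i $$ (b,a)) * frob_sq d (\<lambda>a b. \<tau> j $$ (a,b))"
    unfolding overlap2_def by (rule cauchy_schwarz_frob)
  also have "\<dots> \<le> 1 * 1" unfolding frob_sq_swap[of d "\<lambda>a b. \<tau> i $$ (a,b)"]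
    using frob_le_1 assms by (intro mult_mono) (auto simp: frob_sq_nonneg)
  finally show ?thesis by (simp add: power_le_one_iff)
qed

lemma cmod_overlap3_le_1:
  assumes "i < n" "j < n" "l < n" shows "cmod (overlap3 i j l) \<le> 1"
proof -
  have "(cmod (overlap3 i j l))\<^sup>2 \<le> frob_sq d (\<lambda>a b. \<tau> i $$ (a,b)) *
      (frob_sq d (\<lambda>a b. \<tau> j $$ (a,b)) * frob_sq d (\<lambda>a b. \<tau> l $$ (a,b)))"
    unfolding overlap3_def by (rule cauchy_schwarz_frob3)
  also have "\<dots> \<le> 1 * (1 * 1)"
    using frob_le_1 assms by (intro mult_mono) (auto simp: frob_sq_nonneg)
  finally show ?thesis by (simp add: power_le_one_iff)
qed

lemma overlap2_self: 
  assumes "i < n" shows "0 \<le> Re (overlap2 i i)"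
proof -
  have "Re (\<tau> i $$ (b,a) * \<tau> i $$ (a,b)) \<ge> 0" if "a < d" "b < d" for a b
    by (subst (2) hermitian_entry) (use that assms in auto)
  then show ?thesis unfolding overlap2_def Re_sum by (intro sum_nonneg) auto
qed

text \<open>The entries of the operator \<Delta>, the weighted sum of all states.\<close>

definition signed_sum :: "(nat \<Rightarrow> real) \<Rightarrow> nat \<Rightarrow> nat \<Rightarrow> complex" where
  "signed_sum w a b = (\<Sum>k<n. complex_of_real (w k) * \<tau> k $$ (a,b))"

lemma signed_sum_hermitian:
  "a < d \<Longrightarrow> b < d \<Longrightarrow> signed_sum w a b = cnj (signed_sum w b a)"
  by (auto simp: signed_sum_def hermitian_entry[of _ a b] intro!: sum.cong)

text \<open>By bilinearity the double sum is the trace of \<Delta> squared, which equals the squared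
  Frobenius norm because \<Delta> is Hermitian.\<close>

lemma sum_overlap2:
  "(\<Sum>i<n. \<Sum>j<n. w i * w j * Re (overlap2 i j)) = frob_sq d (signed_sum w)"
proof -
  have "(\<Sum>i<n. \<Sum>j<n. complex_of_real (w i) * complex_of_real (w j) * overlap2 i j) =
      (\<Sum>i<n. \<Sum>j<n. \<Sum>a<d. \<Sum>b<d. (complex_of_real (w i) * \<tau> i $$ (b,a)) * (complex_of_real (w j) * \<tau> j $$ (a,b)))"
    by (simp add: overlap2_def sum_distrib_left mult_ac)
  also have "\<dots> = (\<Sum>i<n. \<Sum>a<d. \<Sum>j<n. \<Sum>b<d. (complex_of_real (w i) * \<tau> i $$ (b,a)) * (complex_of_real (w j) * \<tau> j $$ (a,b)))"
    by (rule sum.cong[OF refl], rule sum.swap)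
  also have "\<dots> = (\<Sum>a<d. \<Sum>i<n. \<Sum>j<n. \<Sum>b<d. (complex_of_real (w i) * \<tau> i $$ (b,a)) * (complex_of_real (w j) * \<tau> j $$ (a,b)))"
    by (rule sum.swap)
  also have "\<dots> = (\<Sum>a<d. \<Sum>i<n. \<Sum>b<d. \<Sum>j<n. (complex_of_real (w i) * \<tau> i $$ (b,a)) * (complex_of_real (w j) * \<tau> j $$ (a,b)))"
    by (rule sum.cong[OF refl], rule sum.cong[OF refl], rule sum.swap)
  also have "\<dots> = (\<Sum>a<d. \<Sum>b<d. \<Sum>i<n. \<Sum>j<n. (complex_of_real (w i) * \<tau> i $$ (b,a)) * (complex_of_real (w j) * \<tau> j $$ (a,b)))"
    by (rule sum.cong[OF refl], rule sum.swap)
  also have "\<dots> = (\<Sum>a<d. \<Sum>b<d. signed_sum w b a * signed_sum w a b)"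
    unfolding signed_sum_def sum_product ..
  also have "\<dots> = (\<Sum>a<d. \<Sum>b<d. complex_of_real ((cmod (signed_sum w a b))\<^sup>2))"
    unfolding complex_norm_square by (intro sum.cong refl) (auto simp: signed_sum_hermitian[symmetric] mult.commute)
  also have "\<dots> = complex_of_real (frob_sq d (signed_sum w))" by (simp add: frob_sq_def)
  finally have "Re (\<Sum>i<n. \<Sum>j<n. complex_of_real (w i) * complex_of_real (w j) * overlap2 i j) = frob_sq d (signed_sum w)"
    by simp
  then show ?thesis by (simp only: Re_sum Re_scale)
qed

text \<open>By linearity the double sum is the trace of \<open>\<tau> i\<close> times \<Delta>
  squared; Cauchy-Schwarz and the purity bound for \<open>\<tau> i\<close> leave the squared
  Frobenius norm of \<Delta>.\<close>

lemma sum_overlap3_le: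
  assumes i: "i < n"
  shows "(\<Sum>j<n. \<Sum>l<n. w j * w l * Re (overlap3 i j l)) \<le> frob_sq d (signed_sum w)"
proof -
  let ?A = "\<lambda>e a. \<tau> i $$ (e,a)" and ?w = "\<lambda>k. complex_of_real (w k)"
  let ?G = "\<lambda>j l (a,b,e). ?A e a * (?w j * \<tau> j $$ (a,b)) * (?w l * \<tau> l $$ (b,e))"
  let ?D = "{..<d} \<times> {..<d} \<times> {..<d}"
  have "(\<Sum>j<n. \<Sum>l<n. ?w j * ?w l * overlap3 i j l) = (\<Sum>j<n. \<Sum>l<n. \<Sum>p\<in>?D. ?G j l p)"
    by (simp add: overlap3_def sum_distrib_left sum.cartesian_product' mult_ac)
  also have "\<dots> = (\<Sum>j<n. \<Sum>p\<in>?D. \<Sum>l<n. ?G j l p)" by (rule sum.cong[OF refl], rule sum.swap)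
  also have "\<dots> = (\<Sum>p\<in>?D. \<Sum>j<n. \<Sum>l<n. ?G j l p)" by (rule sum.swap)
  also have "\<dots> = (\<Sum>(a,b,e)\<in>?D. ?A e a * signed_sum w a b * signed_sum w b e)"
    by (intro sum.cong refl) (simp only: case_prod_unfold signed_sum_def mult.assoc[of "\<tau> i $$ _"], simp only: sum_product, simp only: sum_distrib_left mult.assoc)
  also have "\<dots> = (\<Sum>a<d. \<Sum>b<d. \<Sum>e<d. ?A e a * signed_sum w a b * signed_sum w b e)"
    by (simp add: sum.cartesian_product')
  finally have eq: "(\<Sum>j<n. \<Sum>l<n. ?w j * ?w l * overlap3 i j l) = \<dots>" .
  let ?F = "frob_sq d (signed_sum w)"
  have "(cmod (\<Sum>j<n. \<Sum>l<n. ?w j * ?w l * overlap3 i j l))\<^sup>2 \<le> frob_sq d ?A * (?F * ?F)"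
    unfolding eq by (rule cauchy_schwarz_frob3)
  also have "\<dots> \<le> 1 * (?F * ?F)" using frob_le_1[OF i] by (intro mult_right_mono) (auto simp: frob_sq_nonneg)
  finally have "(cmod (\<Sum>j<n. \<Sum>l<n. ?w j * ?w l * overlap3 i j l))\<^sup>2 \<le> ?F\<^sup>2"
    by (simp only: power2_eq_square mult_1)
  then have "cmod (\<Sum>j<n. \<Sum>l<n. ?w j * ?w l * overlap3 i j l) \<le> ?F"
    by (rule power2_le_imp_le[OF _ frob_sq_nonneg])
  moreover have "Re (\<Sum>j<n. \<Sum>l<n. ?w j * ?w l * overlap3 i j l) = (\<Sum>j<n. \<Sum>l<n. w j * w l * Re (overlap3 i j l))"
    by (simp only: Re_sum Re_scale)
  ultimately show ?thesis
    using complex_Re_le_cmod[of "\<Sum>j<n. \<Sum>l<n. ?w j * ?w l * overlap3 i j l"] by linarith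
qed

text \<open>The full double sum exceeds the mean exactly by the diagonal terms, which are
  \<open>n\<close> purities between 0 and 1.\<close>

lemma swap_obs_mean:
  assumes w: "\<And>i. w i * w i = 1"
  shows "Re (mtrace (swap_obs d n w * tens n \<tau>)) \<le> frob_sq d (signed_sum w)"
    and "frob_sq d (signed_sum w) - real n \<le> Re (mtrace (swap_obs d n w * tens n \<tau>))"
proof -
  let ?f = "\<lambda>i j. w i * w j * Re (overlap2 i j)"
  have "Re (mtrace (swap_obs d n w * tens n \<tau>)) = (\<Sum>i<n. \<Sum>j\<in>{..<n}-{i}. ?f i j)"
    unfolding mtrace_swap_obs sum_off_pairs by (simp only: Re_sum Re_scale)
  also have "\<dots> = (\<Sum>i<n. (\<Sum>j<n. ?f i j) - Re (overlap2 i i))"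
    by (intro sum.cong refl) (simp add: sum_diff1 w)
  also have "\<dots> = frob_sq d (signed_sum w) - (\<Sum>i<n. Re (overlap2 i i))"
    by (simp add: sum_subtractf sum_overlap2)
  finally have *: "Re (mtrace (swap_obs d n w * tens n \<tau>)) = \<dots>" .
  have "0 \<le> (\<Sum>i<n. Re (overlap2 i i))" by (intro sum_nonneg) (auto simp: overlap2_self)
  then show "Re (mtrace (swap_obs d n w * tens n \<tau>)) \<le> frob_sq d (signed_sum w)" unfolding * by simp
  have "(\<Sum>i<n. Re (overlap2 i i)) \<le> (\<Sum>i<n. 1)"
    by (intro sum_mono) (meson cmod_overlap2_le_1 complex_Re_le_cmod lessThan_iff order_trans)
  then show "frob_sq d (signed_sum w) - real n \<le> Re (mtrace (swap_obs d n w * tens n \<tau>))" unfolding * by simp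
qed

lemma swap_obs_variance:
  assumes w: "\<And>i. w i * w i = 1"
  shows "Re (mtrace (swap_obs d n w * swap_obs d n w * tens n \<tau>)) - (Re (mtrace (swap_obs d n w * tens n \<tau>)))\<^sup>2
    \<le> 26 * (real n)\<^sup>2 + 4 * real n * frob_sq d (signed_sum w)"
proof -
  let ?P = "off_pairs n"
  define c where "c i j = Re (overlap2 i j)" for i j
  \<comment> \<open>The covariance of the swaps on (i, j) and (k, l); expanding the variance
    bilinearly gives its weighted sum.\<close>
  define g where "g i j k l = Re (swap_moment i j k l) - c i j * c k l" for i j k l
  have m1: "Re (mtrace (swap_obs d n w * tens n \<tau>)) = (\<Sum>(i,j)\<in>?P. w i * w j * c i j)"
    unfolding mtrace_swap_obs by (simp only: c_def case_prod_unfold Re_sum Re_scale)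
  have m2: "Re (mtrace (swap_obs d n w * swap_obs d n w * tens n \<tau>)) =
      (\<Sum>(i,j)\<in>?P. \<Sum>(k,l)\<in>?P. w i * w j * (w k * w l) * Re (swap_moment i j k l))"
    unfolding mtrace_swap_obs_square by (simp only: case_prod_unfold Re_sum Re_scale)
  have "Re (mtrace (swap_obs d n w * swap_obs d n w * tens n \<tau>)) - (Re (mtrace (swap_obs d n w * tens n \<tau>)))\<^sup>2 =
      (\<Sum>(i,j)\<in>?P. \<Sum>(k,l)\<in>?P. w i * w j * (w k * w l) * g i j k l)"
    unfolding m1 m2 power2_eq_square sum_product
    by (simp add: g_def case_prod_unfold right_diff_distrib sum_subtractf mult_ac)
  also have "\<dots> \<le> 26 * (real n)\<^sup>2 + 4 * real n * frob_sq d (signed_sum w)"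
  proof (rule pair_covariance_bound[where t = "\<lambda>i j l. Re (overlap3 i j l)" and c = c])
    \<comment> \<open>The overlaps are real, so the real part of their product is the product of
      their real parts.\<close>
    show "g i j k l = 0" if "i < n" "j < n" "k < n" "l < n" "i \<noteq> j" "k \<noteq> l" "{i, j} \<inter> {k, l} = {}" for i j k l
      using that by (simp only: g_def c_def swap_moment_disjoint[OF that] times_complex.simps overlap2_real)
    have comm: "overlap2 i j = overlap2 j i" for i j
      unfolding overlap2_def by (subst sum.swap) (simp add: mult.commute)
    show "g i j k l = g i j l k" if "k \<noteq> l" for i j k l
      using swap_moment_commute_right[OF that] comm[of k l] by (simp add: g_def c_def)
    show "g i j k l = g j i k l" if "i \<noteq> j" for i j k l
      using swap_moment_commute_left[OF that] comm[of i j] by (simp add: g_def c_def)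
    show "g i j i j \<le> 1" if "i < n" "j < n" "i \<noteq> j" for i j
      using swap_moment_same[OF that] by (simp add: g_def)
    show "g i j i l = Re (overlap3 i j l) - c i j * c i l"
      if "i < n" "j < n" "l < n" "i \<noteq> j" "l \<noteq> i" "l \<noteq> j" for i j l
      using swap_moment_shared[OF that] by (simp add: g_def)
    show "\<bar>Re (overlap3 i j l)\<bar> \<le> 1" if "i < n" "j < n" "l < n" for i j l
      using cmod_overlap3_le_1[OF that] abs_Re_le_cmod[of "overlap3 i j l"] by linarith
    show "\<bar>c i j\<bar> \<le> 1" if "i < n" "j < n" for i j
      unfolding c_def using cmod_overlap2_le_1[OF that] abs_Re_le_cmod[of "overlap2 i j"] by linarith
  qed (use w sum_overlap3_le in auto)
  finally show ?thesis .
qed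

end

section \<open>The tests\<close>

text \<open>\<open>trace_norm\<close> sums over distinct roots with their orders; once the
  characteristic polynomial is factored this is a sum over the list of eigenvalues with
  repetitions.\<close>

lemma sum_order_linear_factors:
  fixes f :: "complex \<Rightarrow> real"
  defines "P \<equiv> \<lambda>as. \<Prod>a\<leftarrow>as. [:- a, 1:]"
  shows "(\<Sum>z\<in>{x. poly (P as) x = 0}. real (order z (P as)) * f z) = (\<Sum>a\<leftarrow>as. f a)"
proof -
  have nz: "P as \<noteq> 0" for as unfolding P_def by (induction as) (auto simp del: mult_pCons_left)
  have ord: "order z (P as) = count_list as z" for z as
  proof (induction as)
    case (Cons a as)
    have "order z (P (a # as)) = order z [:- a, 1:] + order z (P as)"
      unfolding P_def list.map prod_list.Cons using nz[of as] by (intro order_mult) (simp add: P_def del: mult_pCons_left)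
    also have "order z [:- a, 1:] = (if z = a then 1 else 0)"
      by (auto simp: order_0I)
    finally show ?case using Cons by auto
  qed (simp add: P_def)
  have roots: "{x. poly (P as) x = 0} = set as" unfolding P_def by (induction as) auto
  \<comment> \<open>The sum runs over a fixed finite superset of the roots, so the index set stays
    the same during the induction on the list.\<close>
  have "(\<Sum>z\<in>S. real (count_list as z) * f z) = (\<Sum>a\<leftarrow>as. f a)" if "finite S" "set as \<subseteq> S" for S as
    using that(2)
  proof (induction as)
    case (Cons a as)
    have "(\<Sum>z\<in>S. real (count_list (a # as) z) * f z) =
        (\<Sum>z\<in>S. (if z = a then f a else 0) + real (count_list as z) * f z)"
      by (intro sum.cong refl) (auto simp: algebra_simps)
    then show ?case using Cons that(1) by (simp add: sum.distrib)
  qed simp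
  then show ?thesis unfolding ord roots by simp
qed

text \<open>The trace norm is the sum of the \<open>d\<close> singular values
  \<open>sqrt (e k)\<close>; Cauchy-Schwarz against the all-ones vector yields \<open>d\<close>
  times the sum of their squares.\<close>

lemma trace_norm_sq_le:
  assumes X: "X \<in> carrier_mat d d"
  shows "(trace_norm X)\<^sup>2 \<le> real d * Re (mtrace (mat_adjoint X * X))"
proof -
  let ?H = "mat_adjoint X * X"
  have H: "psd d ?H" by (rule psd_gram[OF X])
  then obtain U and e :: "nat \<Rightarrow> real" where U: "unitary_mat d U"
    and HU: "?H = U * diag_of d (\<lambda>k. complex_of_real (e k)) * mat_adjoint U"
    using hermitian_spectral[of ?H d] unfolding psd_def by blast
  note u = unitary_matD[OF U]
  let ?D = "diag_of d (\<lambda>k. complex_of_real (e k))"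
  have e: "0 \<le> e k" if "k < d" for k
    using psd_conjugation_diag_nonneg[OF H u(1) that] that
    unfolding HU unitary_diagonalize[OF U] by simp
  have "similar_mat_wit ?H ?D U (mat_adjoint U)"
    using u HU H by (intro similar_mat_witI[of _ _ d]) (simp_all add: psd_def)
  then have "similar_mat ?H ?D" unfolding similar_mat_def by blast
  then have "char_poly ?H = char_poly ?D" by (rule char_poly_similar)
  also have "\<dots> = (\<Prod>a\<leftarrow>diag_mat ?D. [:- a, 1:])"
    by (rule char_poly_upper_triangular[of _ d]) auto
  also have "diag_mat ?D = map (\<lambda>k. complex_of_real (e k)) [0..<d]"
    by (auto simp: diag_mat_def)
  finally have "char_poly ?H = (\<Prod>a\<leftarrow>map (\<lambda>k. complex_of_real (e k)) [0..<d]. [:- a, 1:])" .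
  then have "trace_norm X = (\<Sum>k\<leftarrow>[0..<d]. sqrt (cmod (complex_of_real (e k))))"
    unfolding trace_norm_def by (simp only: sum_order_linear_factors, simp only: map_map o_def)
  also have "\<dots> = (\<Sum>k<d. 1 * sqrt (e k))"
    using e by (auto simp: interv_sum_list_conv_sum_set_nat lessThan_atLeast0 intro!: sum.cong)
  finally have tn: "trace_norm X = (\<Sum>k<d. \<bar>1\<bar> * \<bar>sqrt (e k)\<bar>)" using e by simp
  have "(trace_norm X)\<^sup>2 \<le> (L2_set (\<lambda>_. 1) {..<d} * L2_set (\<lambda>k. sqrt (e k)) {..<d})\<^sup>2"
    unfolding tn by (intro power_mono L2_set_mult_ineq) (auto intro!: sum_nonneg)
  also have "\<dots> = real d * (\<Sum>k<d. e k)"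
  proof -
    have "0 \<le> (\<Sum>k<d. e k)" using e by (intro sum_nonneg) auto
    then show ?thesis using e by (simp add: L2_set_def power_mult_distrib)
  qed
  also have "(\<Sum>k<d. e k) = Re (mtrace ?H)"
  proof -
    have "?H = U * ?D * mat_adjoint U * 1\<^sub>m d" using u HU by (simp add: square_mult_carrier)
    then have "mtrace ?H = (\<Sum>k<d. complex_of_real (e k) * (mat_adjoint U * 1\<^sub>m d * U) $$ (k,k))"
      by (simp only: mtrace_spectral[OF U one_carrier_mat])
    also have "\<dots> = (\<Sum>k<d. complex_of_real (e k))" using u by (intro sum.cong) auto
    finally show ?thesis by simp
  qed
  finally show ?thesis .
qed

section \<open>Averages of two families of states\<close>

lemma avg_state_carrier [simp]: "avg_state d T \<rho> \<in> carrier_mat d d"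
  by (simp add: avg_state_def)

locale two_state_families =
  fixes d T :: nat and \<rho> \<sigma> :: "nat \<Rightarrow> complex mat"
  assumes densities: "t < T \<Longrightarrow> density d (\<rho> t) \<and> density d (\<sigma> t)"

sublocale two_state_families \<subseteq> density_states d "2*T" "joint_fun T \<rho> \<sigma>"
  by unfold_locales (auto simp: joint_fun_def densities)

context two_state_families
begin

definition sgn_family :: "nat \<Rightarrow> real" where
  "sgn_family k = (if k < T then 1 else -1)"

abbreviation "avg_diff \<equiv> avg_state d T \<rho> - avg_state d T \<sigma>"

lemma avg_diff_carrier: "avg_diff \<in> carrier_mat d d" by (simp add: minus_carrier_mat)

lemma avg_diff_adjoint_index: "a < d \<Longrightarrow> b < d \<Longrightarrow> mat_adjoint avg_diff $$ (a,b) = cnj (avg_diff $$ (b,a))"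
  by (simp add: avg_state_def)

text \<open>The sum over \<open>2 * T\<close> indices splits at \<open>T\<close>; the second block
  enters with weight -1, and \<open>T\<close> cancels the normalization of the averages.\<close>

lemma signed_sum_eq:
  assumes "T > 0" "a < d" "b < d"
  shows "signed_sum sgn_family a b = of_nat T * avg_diff $$ (a,b)"
proof -
  let ?f = "\<lambda>k. complex_of_real (sgn_family k) * joint_fun T \<rho> \<sigma> k $$ (a,b)"
  have "signed_sum sgn_family a b = (\<Sum>k<T+T. ?f k)" unfolding signed_sum_def by (simp add: mult_2)
  also have "\<dots> = (\<Sum>k<T. ?f k) + (\<Sum>k<T. ?f (k + T))"
    by (simp add: lessThan_atLeast0 sum.atLeastLessThan_concat[of 0 T "T+T", symmetric]
        sum.shift_bounds_nat_ivl[of _ 0 T T, simplified])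
  also have "\<dots> = (\<Sum>k<T. \<rho> k $$ (a,b)) - (\<Sum>k<T. \<sigma> k $$ (a,b))"
    by (simp add: sgn_family_def joint_fun_def sum_negf)
  also have "\<dots> = of_nat T * avg_diff $$ (a,b)" using assms by (simp add: avg_state_def right_diff_distrib)
  finally show ?thesis .
qed

lemma avg_diff_hermitian: "mat_adjoint avg_diff = avg_diff"
proof (cases "T = 0")
  \<comment> \<open>Division by zero is zero here, so both averages are zero matrices.\<close>
  case True
  then show ?thesis by (intro eq_matI) (auto simp: avg_state_def)
next
  case False
  show ?thesis
  proof (rule eq_matI)
    fix a b assume "a < dim_row avg_diff" "b < dim_col avg_diff"
    then have ab: "a < d" "b < d" using avg_diff_carrier by auto
    have "of_nat T * cnj (avg_diff $$ (b,a)) = of_nat T * avg_diff $$ (a,b)"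
      using signed_sum_eq[of a b] signed_sum_eq[of b a] signed_sum_hermitian[of a b sgn_family] ab False by simp
    then show "mat_adjoint avg_diff $$ (a,b) = avg_diff $$ (a,b)"
      unfolding avg_diff_adjoint_index[OF ab] using False by (simp del: index_minus_mat)
  qed (simp_all add: avg_state_def)
qed

lemma frob_signed_sum:
  assumes "T > 0"
  shows "frob_sq d (signed_sum sgn_family) = (real T)\<^sup>2 * D_HS_sq (avg_state d T \<rho>) (avg_state d T \<sigma>)"
proof -
  have "mtrace (avg_diff * avg_diff) = (\<Sum>a<d. \<Sum>b<d. avg_diff $$ (a,b) * avg_diff $$ (b,a))"
    using avg_diff_carrier mult_mat_index[OF avg_diff_carrier avg_diff_carrier]
    by (simp add: mtrace_def carrier_matD[OF avg_diff_carrier] del: index_mult_mat(1) index_minus_mat)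
  also have "\<dots> = (\<Sum>a<d. \<Sum>b<d. complex_of_real ((cmod (avg_diff $$ (a,b)))\<^sup>2))"
  proof (intro sum.cong refl)
    fix a b assume "a \<in> {..<d}" "b \<in> {..<d}"
    then have "avg_diff $$ (b,a) = cnj (avg_diff $$ (a,b))"
      using avg_diff_adjoint_index[of b a] unfolding avg_diff_hermitian by (simp del: index_minus_mat)
    then show "avg_diff $$ (a,b) * avg_diff $$ (b,a) = complex_of_real ((cmod (avg_diff $$ (a,b)))\<^sup>2)"
      by (simp only: complex_norm_square)
  qed
  finally have "D_HS_sq (avg_state d T \<rho>) (avg_state d T \<sigma>) = (\<Sum>a<d. \<Sum>b<d. (cmod (avg_diff $$ (a,b)))\<^sup>2)"
    unfolding D_HS_sq_def by simp
  moreover have "frob_sq d (signed_sum sgn_family) = (\<Sum>a<d. \<Sum>b<d. (real T)\<^sup>2 * (cmod (avg_diff $$ (a,b)))\<^sup>2)"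
    unfolding frob_sq_def using signed_sum_eq[OF assms]
    by (intro sum.cong refl) (simp add: norm_mult power_mult_distrib del: index_minus_mat)
  ultimately show ?thesis by (simp add: sum_distrib_left)
qed

text \<open>The factor 4 is the square of the 1/2 in the trace distance.\<close>

lemma D_tr_sq_le:
  "4 * (D_tr (avg_state d T \<rho>) (avg_state d T \<sigma>))\<^sup>2 \<le> real d * D_HS_sq (avg_state d T \<rho>) (avg_state d T \<sigma>)"
  using trace_norm_sq_le[OF avg_diff_carrier] unfolding avg_diff_hermitian by (simp add: D_tr_def D_HS_sq_def power2_eq_square)

lemma psd_joint_state: "psd (d ^ (2*T)) (joint_state T \<rho> \<sigma>)"
  unfolding joint_state_eq_tens using density by (intro psd_tens) (auto simp: density_def)

lemma mtrace_joint_state: "mtrace (joint_state T \<rho> \<sigma>) = 1"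
  unfolding joint_state_eq_tens using carrier trace_one by (simp add: tens_mtrace[of _ _ d])

text \<open>The general bounds at \<open>n = 2 * T\<close>, with squared Frobenius norm
  \<open>T^2 * D\<close>: 26 becomes 104, and \<open>4 * n\<close> becomes
  \<open>8 * T\<close>.\<close>

lemma swap_obs_joint_state:
  assumes "T > 0"
  defines "D \<equiv> D_HS_sq (avg_state d T \<rho>) (avg_state d T \<sigma>)"
    and "Y \<equiv> swap_obs d (2*T) sgn_family"
  defines "m \<equiv> Re (mtrace (Y * joint_state T \<rho> \<sigma>))"
  shows "m \<le> (real T)\<^sup>2 * D" "(real T)\<^sup>2 * D - 2 * real T \<le> m"
    "Re (mtrace (Y * Y * joint_state T \<rho> \<sigma>)) - m\<^sup>2 \<le> (real T)\<^sup>2 * (104 + 8 * (real T * D))"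
proof -
  have w: "sgn_family i * sgn_family i = 1" for i by (simp add: sgn_family_def)
  show "m \<le> (real T)\<^sup>2 * D" "(real T)\<^sup>2 * D - 2 * real T \<le> m"
    using swap_obs_mean[of sgn_family, OF w] frob_signed_sum[OF assms(1)] by (simp_all add: m_def Y_def D_def joint_state_eq_tens)
  show "Re (mtrace (Y * Y * joint_state T \<rho> \<sigma>)) - m\<^sup>2 \<le> (real T)\<^sup>2 * (104 + 8 * (real T * D))"
    using swap_obs_variance[of sgn_family, OF w] unfolding m_def Y_def D_def joint_state_eq_tens frob_signed_sum[OF assms(1)]
    by (simp add: power2_eq_square algebra_simps)
qed

end

section \<open>Error probabilities and the choice of constants\<close>

text \<open>The variance is linear in \<open>v\<close> while the squared gap is quadratic, so their
  ratio is small for large \<open>v\<close>.\<close>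

lemma variance_ratio_bound:
  fixes t v V s :: real
  assumes t: "t > 0" and v: "v \<ge> 10^8" and V: "V \<le> t\<^sup>2 * (104 + 8 * v)" and s: "s \<ge> t * (v / 250)"
  shows "V / s\<^sup>2 \<le> 0.01"
proof -
  have v0: "v > 0" using v by simp
  have "(t * (v / 250))\<^sup>2 \<le> s\<^sup>2" using t v0 s by (intro power_mono) auto
  moreover have "V \<le> (t * (v / 250))\<^sup>2 / 100"
  proof -
    have "v * 100000000 \<le> v * v" using v v0 by (intro mult_left_mono) auto
    moreover have "v \<ge> 100000000" using v by simp
    \<comment> \<open>For \<open>v\<close> at least 10^8 the right side is at least
      \<open>16 * v\<close>, and the surplus \<open>8 * v\<close> covers 104.\<close>
    ultimately have "104 + 8 * v \<le> (v * v / 62500) / 100" by linarith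
    then have "104 + 8 * v \<le> (v / 250)\<^sup>2 / 100" by (simp add: power2_eq_square)
    then have "t\<^sup>2 * (104 + 8 * v) \<le> t\<^sup>2 * ((v / 250)\<^sup>2 / 100)" using t by (intro mult_left_mono) auto
    then show ?thesis using V by (simp add: power_mult_distrib power_divide)
  qed
  ultimately have "V \<le> s\<^sup>2 / 100" by linarith
  moreover have "s\<^sup>2 > 0" using s t v0 by (smt (verit) divide_pos_pos mult_pos_pos zero_less_power)
  ultimately show ?thesis by (simp add: pos_divide_le_eq)
qed

lemma HS_test:
  fixes \<theta> :: real
  assumes \<theta>: "\<theta> \<ge> 0" "real T * \<theta> \<ge> 10^8"
  obtains M where "two_outcome_povm (d ^ (2*T)) M"
    "\<And>\<rho> \<sigma>. (\<forall>t<T. density d (\<rho> t) \<and> density d (\<sigma> t)) \<Longrightarrow>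
      D_HS_sq (avg_state d T \<rho>) (avg_state d T \<sigma>) \<le> 0.99 * \<theta> \<Longrightarrow> accept_prob M (joint_state T \<rho> \<sigma>) \<ge> 0.99"
    "\<And>\<rho> \<sigma>. (\<forall>t<T. density d (\<rho> t) \<and> density d (\<sigma> t)) \<Longrightarrow>
      D_HS_sq (avg_state d T \<rho>) (avg_state d T \<sigma>) > \<theta> \<Longrightarrow> 1 - accept_prob M (joint_state T \<rho> \<sigma>) \<ge> 0.99"
proof -
  have T: "T > 0" using \<theta> by (cases T) auto
  \<comment> \<open>This weight depends on \<open>T\<close> alone, so the observable and the
    measurement are fixed before the states are.\<close>
  define w where "w = two_state_families.sgn_family T"
  define Y where "Y = swap_obs d (2*T) w"
  \<comment> \<open>\<open>T^2\<close> times the midpoint of the two thresholds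
    \<open>0.99 * \<theta>\<close> and \<open>\<theta>\<close>.\<close>
  define r where "r = real T * (0.995 * (real T * \<theta>))"
  obtain M where M: "two_outcome_povm (d ^ (2*T)) M"
    and acc: "\<And>R. psd (d ^ (2*T)) R \<Longrightarrow> mtrace R = 1 \<Longrightarrow> Re (mtrace (Y * R)) < r \<Longrightarrow>
       1 - accept_prob M R \<le> (Re (mtrace (Y * Y * R)) - (Re (mtrace (Y * R)))\<^sup>2) / (r - Re (mtrace (Y * R)))\<^sup>2"
    and rej: "\<And>R. psd (d ^ (2*T)) R \<Longrightarrow> mtrace R = 1 \<Longrightarrow> r < Re (mtrace (Y * R)) \<Longrightarrow>
       accept_prob M R \<le> (Re (mtrace (Y * Y * R)) - (Re (mtrace (Y * R)))\<^sup>2) / (Re (mtrace (Y * R)) - r)\<^sup>2"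
    using threshold_measurement[of Y "d ^ (2*T)" r] swap_obs_hermitian swap_obs_carrier
    unfolding Y_def by blast
  show ?thesis
  proof (rule that[OF M])
    fix \<rho> \<sigma> assume dens: "\<forall>t<T. density d (\<rho> t) \<and> density d (\<sigma> t)"
    interpret two_state_families d T \<rho> \<sigma> using dens by unfold_locales auto
    let ?R = "joint_state T \<rho> \<sigma>"
    define D where "D = D_HS_sq (avg_state d T \<rho>) (avg_state d T \<sigma>)"
    define m where "m = Re (mtrace (Y * ?R))"
    define V where "V = Re (mtrace (Y * Y * ?R)) - m\<^sup>2"
    have m: "m \<le> real T * (real T * D)" "real T * (real T * D - 2) \<le> m"
      and V: "V \<le> (real T)\<^sup>2 * (104 + 8 * (real T * D))"
      using swap_obs_joint_state[OF T] by (simp_all add: m_def V_def D_def Y_def w_def power2_eq_square algebra_simps)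
    {
      assume "D_HS_sq (avg_state d T \<rho>) (avg_state d T \<sigma>) \<le> 0.99 * \<theta>"
      then have "real T * D \<le> real T * (0.99 * \<theta>)" using T by (intro mult_left_mono) (auto simp: D_def)
      then have TD: "real T * D \<le> 0.99 * (real T * \<theta>)" by simp
      then have "m \<le> real T * (0.99 * (real T * \<theta>))"
        using m(1) T by (meson mult_left_mono of_nat_0_le_iff order_trans)
      \<comment> \<open>The fraction 1/250 fits because 0.99 + 0.004 is below 0.995.\<close>
      moreover have "real T * (0.99 * (real T * \<theta>) + real T * \<theta> / 250) \<le> r" unfolding r_def
        by (intro mult_left_mono) (use \<theta>(1) in auto)
      ultimately have gap: "r - m \<ge> real T * (real T * \<theta> / 250)"
        unfolding distrib_left by linarith
      \<comment> \<open>\<open>D\<close> may be tiny in this case, so the variance is measured by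
        \<open>\<theta>\<close> instead.\<close>
      have "(104 + 8 * (real T * D)) \<le> 104 + 8 * (real T * \<theta>)" using TD \<theta>(2) by simp
      then have "V \<le> (real T)\<^sup>2 * (104 + 8 * (real T * \<theta>))"
        using V by (meson mult_left_mono zero_le_power2 order_trans)
      then have "V / (r - m)\<^sup>2 \<le> 0.01" using T \<theta>(2) gap by (intro variance_ratio_bound) auto
      moreover have "m < r"
      proof -
        have "real T * (real T * \<theta> / 250) > 0" using T \<theta>(2) by simp
        then show ?thesis using gap by linarith
      qed
      ultimately have "1 - accept_prob M ?R \<le> 0.01"
        using acc[OF psd_joint_state mtrace_joint_state] unfolding m_def V_def by (meson order_trans)
      then show "accept_prob M ?R \<ge> 0.99" by simp
    }
    {
      assume "D_HS_sq (avg_state d T \<rho>) (avg_state d T \<sigma>) > \<theta>"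
      then have TD: "real T * \<theta> \<le> real T * D" using T by (simp add: D_def)
      \<comment> \<open>\<open>D\<close> may far exceed \<open>\<theta>\<close> here and the
        variance grows with it; the gap must therefore be a fraction of
        \<open>T^2 * D\<close>.\<close>
      have "real T * (0.995 * (real T * \<theta>) + real T * D / 250) \<le> real T * (real T * D - 2)"
      proof (rule mult_left_mono)
        \<comment> \<open>The slack is at least \<open>v / 1000\<close>, which absorbs the 2 coming
          from the missing purities.\<close>
        have "0.995 * u + v / 250 \<le> v - 2" if "u \<le> v" "100000000 \<le> u" for u v :: real
          using that by simp
        then show "0.995 * (real T * \<theta>) + real T * D / 250 \<le> real T * D - 2"
          using TD \<theta>(2) by simp
      qed simp
      then have gap: "m - r \<ge> real T * (real T * D / 250)" using m(2)
        unfolding r_def distrib_left by linarith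
      have v: "10^8 \<le> real T * D" using \<theta>(2) TD by (rule order_trans)
      then have "V / (m - r)\<^sup>2 \<le> 0.01" using T gap V by (intro variance_ratio_bound[OF _ v]) auto
      moreover have "r < m"
      proof -
        have "real T * (real T * D / 250) > 0" using T v by simp
        then show ?thesis using gap by linarith
      qed
      ultimately have "accept_prob M ?R \<le> 0.01"
        using rej[OF psd_joint_state mtrace_joint_state] unfolding m_def V_def by (meson order_trans)
      then show "1 - accept_prob M ?R \<ge> 0.99" by simp
    }
  qed
qed

theorem theorem2p5:
  shows "\<exists>K::real. K > 0 \<and>
   (\<forall>(d::nat) (\<theta>::real) (T::nat). \<theta> \<ge> 0 \<and> real T * \<theta> \<ge> K \<longrightarrow>
      (\<exists>M. two_outcome_povm (d ^ (2*T)) M \<and>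
        (\<forall>\<rho> \<sigma>. (\<forall>t<T. density d (\<rho> t) \<and> density d (\<sigma> t)) \<longrightarrow>
          (D_HS_sq (avg_state d T \<rho>) (avg_state d T \<sigma>) \<le> 0.99 * \<theta> \<longrightarrow>
             accept_prob M (joint_state T \<rho> \<sigma>) \<ge> 0.99) \<and>
          (D_HS_sq (avg_state d T \<rho>) (avg_state d T \<sigma>) > \<theta> \<longrightarrow>
             1 - accept_prob M (joint_state T \<rho> \<sigma>) \<ge> 0.99)))) \<and>
   (\<forall>(d::nat) (\<epsilon>::real) (T::nat). \<epsilon> > 0 \<and> real T \<ge> K * real d / \<epsilon>\<^sup>2 \<longrightarrow>
      (\<exists>M. two_outcome_povm (d ^ (2*T)) M \<and>
        (\<forall>\<rho> \<sigma>. (\<forall>t<T. density d (\<rho> t) \<and> density d (\<sigma> t)) \<longrightarrow>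
          (avg_state d T \<rho> = avg_state d T \<sigma> \<longrightarrow>
             accept_prob M (joint_state T \<rho> \<sigma>) \<ge> 0.99) \<and>
          (D_tr (avg_state d T \<rho>) (avg_state d T \<sigma>) > \<epsilon> \<longrightarrow>
             1 - accept_prob M (joint_state T \<rho> \<sigma>) \<ge> 0.99))))"
proof (rule exI[of _ "10^8"], intro conjI allI impI; (elim conjE)?)
  show "(0::real) < 10^8" by simp
next
  fix d T :: nat and \<theta> :: real
  assume "0 \<le> \<theta>" "10^8 \<le> real T * \<theta>"
  then show "\<exists>M. two_outcome_povm (d ^ (2*T)) M \<and>
        (\<forall>\<rho> \<sigma>. (\<forall>t<T. density d (\<rho> t) \<and> density d (\<sigma> t)) \<longrightarrow>
          (D_HS_sq (avg_state d T \<rho>) (avg_state d T \<sigma>) \<le> 0.99 * \<theta> \<longrightarrow>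
             accept_prob M (joint_state T \<rho> \<sigma>) \<ge> 0.99) \<and>
          (D_HS_sq (avg_state d T \<rho>) (avg_state d T \<sigma>) > \<theta> \<longrightarrow>
             1 - accept_prob M (joint_state T \<rho> \<sigma>) \<ge> 0.99))"
    using HS_test[of \<theta> T d] by metis
next
  fix d T :: nat and \<epsilon> :: real
  assume eps: "0 < \<epsilon>" and Tge: "10^8 * real d / \<epsilon>\<^sup>2 \<le> real T"
  \<comment> \<open>Large trace distance forces large Hilbert-Schmidt distance, reducing the second
    claim to the first.\<close>
  have tr_HS: "4 * \<epsilon>\<^sup>2 < real d * D_HS_sq (avg_state d T \<rho>) (avg_state d T \<sigma>)"
    if "\<forall>t<T. density d (\<rho> t) \<and> density d (\<sigma> t)" "D_tr (avg_state d T \<rho>) (avg_state d T \<sigma>) > \<epsilon>" for \<rho> \<sigma>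
  proof -
    interpret two_state_families d T \<rho> \<sigma> using that by unfold_locales auto
    have "\<epsilon>\<^sup>2 < (D_tr (avg_state d T \<rho>) (avg_state d T \<sigma>))\<^sup>2"
      using eps that(2) by (intro power_strict_mono) auto
    then show ?thesis using D_tr_sq_le by linarith
  qed
  show "\<exists>M. two_outcome_povm (d ^ (2*T)) M \<and>
        (\<forall>\<rho> \<sigma>. (\<forall>t<T. density d (\<rho> t) \<and> density d (\<sigma> t)) \<longrightarrow>
          (avg_state d T \<rho> = avg_state d T \<sigma> \<longrightarrow>
             accept_prob M (joint_state T \<rho> \<sigma>) \<ge> 0.99) \<and>
          (D_tr (avg_state d T \<rho>) (avg_state d T \<sigma>) > \<epsilon> \<longrightarrow>
             1 - accept_prob M (joint_state T \<rho> \<sigma>) \<ge> 0.99))"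
  proof (cases "d = 0")
    \<comment> \<open>The threshold \<open>4 * \<epsilon>\<^sup>2 / d\<close> makes no sense here,
      but by \<open>tr_HS\<close> the far case is impossible, so always accepting is a valid
      test.\<close>
    case True
    let ?N = "d ^ (2*T)"
    have "two_outcome_povm ?N (1\<^sub>m ?N)"
    proof -
      have eq: "1\<^sub>m ?N - 1\<^sub>m ?N = mat_adjoint (0\<^sub>m ?N ?N) * 0\<^sub>m ?N ?N" by (intro eq_matI) auto
      have "psd ?N (1\<^sub>m ?N - 1\<^sub>m ?N)" unfolding eq by (rule psd_gram, rule zero_carrier_mat)
      then show ?thesis using psd_gram[of "1\<^sub>m ?N" ?N ?N] by (simp add: two_outcome_povm_def)
    qed
    moreover have "accept_prob (1\<^sub>m ?N) (joint_state T \<rho> \<sigma>) \<ge> 0.99"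
      if "\<forall>t<T. density d (\<rho> t) \<and> density d (\<sigma> t)" for \<rho> \<sigma>
    proof -
      interpret two_state_families d T \<rho> \<sigma> using that by unfold_locales auto
      show ?thesis using psd_joint_state mtrace_joint_state
        by (simp add: accept_prob_def psd_def left_mult_one_mat[of _ ?N ?N])
    qed
    moreover have "\<not> 4 * \<epsilon>\<^sup>2 < real d * x" for x using True by simp
    ultimately show ?thesis using tr_HS by blast
  next
    case False
    \<comment> \<open>Chosen so that \<open>tr_HS\<close> reads \<open>D_HS_sq > \<theta>\<close>.
      Equal averages have distance 0 and fall into the accepting case.\<close>
    define \<theta> where "\<theta> = 4 * \<epsilon>\<^sup>2 / real d"
    have "10^8 * real d \<le> real T * \<epsilon>\<^sup>2" using Tge eps by (simp add: pos_divide_le_eq)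
    moreover have "0 \<le> real T * \<epsilon>\<^sup>2" by simp
    ultimately have "10^8 * real d \<le> 4 * (real T * \<epsilon>\<^sup>2)" by linarith
    then have "10^8 \<le> real T * \<theta>" using False by (simp add: \<theta>_def field_simps)
    moreover have \<theta>0: "0 \<le> \<theta>" by (simp add: \<theta>_def)
    ultimately obtain M where M: "two_outcome_povm (d ^ (2*T)) M"
      "\<And>\<rho> \<sigma>. (\<forall>t<T. density d (\<rho> t) \<and> density d (\<sigma> t)) \<Longrightarrow>
        D_HS_sq (avg_state d T \<rho>) (avg_state d T \<sigma>) \<le> 0.99 * \<theta> \<Longrightarrow> accept_prob M (joint_state T \<rho> \<sigma>) \<ge> 0.99"
      "\<And>\<rho> \<sigma>. (\<forall>t<T. density d (\<rho> t) \<and> density d (\<sigma> t)) \<Longrightarrow>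
        D_HS_sq (avg_state d T \<rho>) (avg_state d T \<sigma>) > \<theta> \<Longrightarrow> 1 - accept_prob M (joint_state T \<rho> \<sigma>) \<ge> 0.99"
      using HS_test[of \<theta> T d] by metis
    have "D_HS_sq A A \<le> 0.99 * \<theta>" if "A \<in> carrier_mat d d" for A
    proof -
      have "A - A = 0\<^sub>m d d" using that by (intro eq_matI) auto
      then show ?thesis using \<theta>0 by (simp add: D_HS_sq_def mtrace_def)
    qed
    then have "accept_prob M (joint_state T \<rho> \<sigma>) \<ge> 0.99"
      if "\<forall>t<T. density d (\<rho> t) \<and> density d (\<sigma> t)" "avg_state d T \<rho> = avg_state d T \<sigma>" for \<rho> \<sigma>
      using that M(2)[of \<rho> \<sigma>] by simp
    moreover have "1 - accept_prob M (joint_state T \<rho> \<sigma>) \<ge> 0.99"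
      if "\<forall>t<T. density d (\<rho> t) \<and> density d (\<sigma> t)" "D_tr (avg_state d T \<rho>) (avg_state d T \<sigma>) > \<epsilon>" for \<rho> \<sigma>
      using M(3)[OF that(1)] tr_HS[OF that] False by (simp add: \<theta>_def field_simps)
    ultimately show ?thesis using M(1) by blast
  qed
qed

end
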